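(* Let $c\in(0,\frac12)$ be a fixed rational number, let $m=cn$ where $n$ and $m$ are integers, and let $M$ be the adjacency matrix of the dense Barabási–Albert multigraph on $n$ vertices with parameter $m$ (defined in the context). Then the largest eigenvalue of the scaled adjacency matrix satisfies $$\lambda_{\max}\left(\frac{M}{\sqrt{m}}\right)=\frac{\alpha(c)}{\sqrt{c}}\sqrt{n}+o_{\mathbb{P}}(\sqrt n),\qquad n\to\infty,$$ with $$\alpha(c)=c+\frac c2\log\frac{2-c}{c}.$$
   Context: Model. Fix rational $c\in(0,\frac12)$ and consider only integers $n$ such that $m:=cn$ is an integer; limits are along this sequence. Let $t_0:=m+1$. At time $t_0$ the graph is the simple complete graph on vertices $1,\dots,m+1$. For each $t=t_0+1,\dots,n$ a new vertex $t$ is added together with $m$ edges; conditionally on the graph at time $t-1$, the $m$ edges are placed independently, each joining $t$ to vertex $j<t$ with probability $d_j(t-1)/D_{t-1}$, where $d_j(s)$ is the degree of $j$ at time $s$ (counted with edge multiplicity) and $D_s=\sum_{v\le s}d_v(s)=2ms-m(m+1)$ for $s\ge t_0$. Multiple edges are allowed. $M$ is the symmetric $n\times n$ matrix whose $(k,j)$ entry is the number of edges between $k$ and $j$ in the final graph (with $M_{kk}=0$). $X_n=o_{\mathbb{P}}(a_n)$ means $X_n/a_n\to0$ in probability. *)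

theory Defs
  imports
    "HOL-Probability.Probability"
    "Jordan_Normal_Form.Spectral_Radius"
begin

section \<open>Dense Barabasi--Albert multigraphs\<close>

text \<open>
  A multigraph on the vertices \<open>1, 2, \<dots>\<close> is given by its edge multiplicities: \<open>G k j\<close> is the
  number of edges between \<open>k\<close> and \<open>j\<close>.  A multigraph at time \<open>s\<close> has vertex set \<open>{1..s}\<close>.
\<close>
type_synonym multigraph = "nat \<Rightarrow> nat \<Rightarrow> nat"

definition complete_multigraph :: "nat \<Rightarrow> multigraph" where
  "complete_multigraph s = (\<lambda>k j. if k \<in> {1..s} \<and> j \<in> {1..s} \<and> k \<noteq> j then 1 else 0)"

definition deg :: "nat \<Rightarrow> multigraph \<Rightarrow> nat \<Rightarrow> nat" where
  "deg s G j = (\<Sum>k\<in>{1..s}. G j k)"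

definition total_deg :: "nat \<Rightarrow> multigraph \<Rightarrow> nat" where
  "total_deg s G = (\<Sum>v\<in>{1..s}. deg s G v)"

text \<open>
  Degree-proportional choice of a vertex of \<open>{1..s}\<close>.  It is a genuine distribution whenever
  \<open>total_deg s G > 0\<close> (see \<open>pmf_pref_vertex\<close>), hence for all multigraphs that occur in the
  process with \<open>m \<ge> 1\<close> (see \<open>total_deg_BA_at\<close>).
\<close>
definition pref_vertex :: "nat \<Rightarrow> multigraph \<Rightarrow> nat pmf" where
  "pref_vertex s G =
     embed_pmf (\<lambda>j. if j \<in> {1..s} then real (deg s G j) / real (total_deg s G) else 0)"

definition add_vertex :: "nat \<Rightarrow> nat list \<Rightarrow> multigraph \<Rightarrow> multigraph" where
  "add_vertex t xs G =
     (\<lambda>k j. if k = t then count_list xs j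
            else if j = t then count_list xs k
            else G k j)"

definition BA_step :: "nat \<Rightarrow> nat \<Rightarrow> multigraph \<Rightarrow> multigraph pmf" where
  "BA_step m t G = map_pmf (\<lambda>xs. add_vertex t xs G) (replicate_pmf m (pref_vertex (t - 1) G))"

text \<open>\<open>BA_at m i\<close> is the law of the multigraph at time \<open>m + 1 + i\<close>.\<close>
primrec BA_at :: "nat \<Rightarrow> nat \<Rightarrow> multigraph pmf" where
  "BA_at m 0 = return_pmf (complete_multigraph (m + 1))"
| "BA_at m (Suc i) = bind_pmf (BA_at m i) (BA_step m (m + 1 + Suc i))"

text \<open>The law of the final multigraph on \<open>n \<ge> m + 1\<close> vertices.\<close>
definition dense_BA :: "nat \<Rightarrow> nat \<Rightarrow> multigraph pmf" where
  "dense_BA n m = BA_at m (n - (m + 1))"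

text \<open>Matrix indices start at \<open>0\<close>, vertices at \<open>1\<close>.\<close>
definition adjacency_mat :: "nat \<Rightarrow> multigraph \<Rightarrow> real mat" where
  "adjacency_mat n G = mat n n (\<lambda>(k, j). real (G (k + 1) (j + 1)))"

text \<open>Used for real symmetric matrices only, whose eigenvalues are all real.\<close>
definition lambda_max :: "real mat \<Rightarrow> real" where
  "lambda_max A = Max (spectrum A)"

definition alpha :: "real \<Rightarrow> real" where
  "alpha c = c + c / 2 * ln ((2 - c) / c)"

text \<open>
  \<open>X\<^sub>n = o\<^sub>P(a\<^sub>n)\<close> along the filter \<open>F\<close>, where \<open>X\<^sub>n\<close> lives on the probability space \<open>\<Omega>\<^sub>n\<close>.
\<close>
definition small_o_prob ::
  "nat filter \<Rightarrow> (nat \<Rightarrow> 'a measure) \<Rightarrow> (nat \<Rightarrow> 'a \<Rightarrow> real) \<Rightarrow> (nat \<Rightarrow> real) \<Rightarrow> bool" where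
  "small_o_prob F \<Omega> X a \<longleftrightarrow>
     (\<forall>\<epsilon>>0. ((\<lambda>n. measure (\<Omega> n) {\<omega> \<in> space (\<Omega> n). \<bar>X n \<omega> / a n\<bar> > \<epsilon>}) \<longlongrightarrow> 0) F)"

text \<open>\<open>n \<rightarrow> \<infinity>\<close> along those \<open>n\<close> for which \<open>c n\<close> is an integer.\<close>
definition integral_multiples :: "real \<Rightarrow> nat filter" where
  "integral_multiples c = inf sequentially (principal {n. c * real n \<in> \<int>})"


section \<open>Well-definedness\<close>

lemma pmf_pref_vertex:
  assumes "total_deg s G > 0"
  shows "pmf (pref_vertex s G) j =
           (if j \<in> {1..s} then real (deg s G j) / real (total_deg s G) else 0)"
  unfolding pref_vertex_def
proof (rule pmf_embed_pmf)
  let ?f = "\<lambda>j. if j \<in> {1..s} then real (deg s G j) / real (total_deg s G) else 0"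
  show "0 \<le> ?f x" for x by simp
  have "(\<integral>\<^sup>+ x. ennreal (?f x) \<partial>count_space UNIV) =
        (\<integral>\<^sup>+ x. ennreal (?f x) \<partial>count_space {1..s})"
    by (rule nn_integral_count_space_eq) auto
  also have "\<dots> = (\<Sum>x\<in>{1..s}. ennreal (?f x))"
    by (rule nn_integral_count_space_finite) simp
  also have "\<dots> = ennreal (\<Sum>x\<in>{1..s}. ?f x)"
    by (rule sum_ennreal) simp
  also have "(\<Sum>x\<in>{1..s}. ?f x) = (\<Sum>x\<in>{1..s}. real (deg s G x)) / real (total_deg s G)"
    by (simp add: sum_divide_distrib)
  also have "\<dots> = 1"
    using assms unfolding total_deg_def of_nat_sum[symmetric] by (metis divide_self of_nat_0_less_iff less_irrefl)
  finally show "(\<integral>\<^sup>+ x. ennreal (?f x) \<partial>count_space UNIV) = 1" by simp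
qed

lemma set_pref_vertex:
  assumes "total_deg s G > 0"
  shows "set_pmf (pref_vertex s G) \<subseteq> {1..s}"
  using pmf_pref_vertex[OF assms] by (auto simp: set_pmf_eq split: if_splits)

lemma total_deg_complete: "total_deg s (complete_multigraph s) = s * (s - 1)"
proof -
  have "deg s (complete_multigraph s) j = s - 1" if "j \<in> {1..s}" for j
  proof -
    have "deg s (complete_multigraph s) j = (\<Sum>k\<in>{1..s}. if k \<in> {1..s} - {j} then 1 else 0)"
      unfolding deg_def complete_multigraph_def using that by (intro sum.cong) auto
    also have "\<dots> = card ({1..s} \<inter> ({1..s} - {j}))"
      by (simp only: sum.If_cases[OF finite_atLeastAtMost] Int_def) simp
    also have "{1..s} \<inter> ({1..s} - {j}) = {1..s} - {j}" by auto
    finally show ?thesis using that by simp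
  qed
  then show ?thesis by (simp add: total_deg_def)
qed

lemma total_deg_add_vertex:
  assumes "set xs \<subseteq> {1..s}"
  shows "total_deg (Suc s) (add_vertex (Suc s) xs G) = total_deg s G + 2 * length xs"
proof -
  have new: "(\<Sum>k\<in>{1..s}. count_list xs k) = length xs"
    using sum_count_set[OF assms] by simp
  have [simp]: "count_list xs (Suc s) = 0"
    using assms by (auto simp: count_list_0_iff)
  have "deg (Suc s) (add_vertex (Suc s) xs G) j = deg s G j + count_list xs j"
    if "j \<in> {1..s}" for j
    using that by (simp add: deg_def add_vertex_def)
  moreover have "deg (Suc s) (add_vertex (Suc s) xs G) (Suc s) = length xs"
    using new by (simp add: deg_def add_vertex_def)
  ultimately show ?thesis
    using new by (simp add: total_deg_def sum.distrib)
qed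

text \<open>With \<open>s = m + 1 + i\<close> the right-hand side equals \<open>2 m s - m (m + 1)\<close>.\<close>
lemma total_deg_BA_at:
  assumes "m \<ge> 1" "G \<in> set_pmf (BA_at m i)"
  shows "total_deg (m + 1 + i) G = 2 * m * (m + 1 + i) - m * (m + 1)"
  using assms(2)
proof (induction i arbitrary: G)
  case 0
  then have "total_deg (m + 1 + 0) G = (m + 1) * m"
    using total_deg_complete[of "m + 1"] by simp
  then show ?case by (simp add: algebra_simps)
next
  case (Suc i)
  let ?s = "m + 1 + i"
  from Suc.prems obtain H xs where H: "H \<in> set_pmf (BA_at m i)"
    and xs: "xs \<in> set_pmf (replicate_pmf m (pref_vertex ?s H))"
    and G: "G = add_vertex (Suc ?s) xs H"
    by (auto simp: BA_step_def)
  have IH: "total_deg ?s H = 2 * m * ?s - m * (m + 1)" by (rule Suc.IH[OF H])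
  have ge: "m * (m + 1) < 2 * m * ?s" using assms(1) by (simp add: algebra_simps)
  have "set_pmf (pref_vertex ?s H) \<subseteq> {1..?s}"
    by (rule set_pref_vertex) (use IH ge in simp)
  then have "set xs \<subseteq> {1..?s}" "length xs = m"
    using xs by (auto simp: set_replicate_pmf lists_eq_set)
  then have "total_deg (Suc ?s) G = 2 * m * ?s - m * (m + 1) + 2 * m"
    using total_deg_add_vertex[of xs ?s H] IH G by simp
  moreover have "m + 1 + Suc i = Suc ?s" by simp
  moreover have "2 * m * Suc ?s - m * (m + 1) = 2 * m * ?s - m * (m + 1) + 2 * m"
    using ge by simp
  ultimately show ?case by presburger
qed

end

theory Submission
  imports Defs "HOL-Real_Asymp.Real_Asymp"
begin

text \<open>
  At time \<open>s\<close> the total degree is \<open>m x\<^sub>s\<close> with \<open>x\<^sub>s = 2 s - m - 1\<close>, so a step multiplies the conditional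
  mean of every existing degree by \<open>1 + 1 / x\<^sub>s\<close>.  With \<open>g\<^sub>s\<close> the product of these factors up to
  time \<open>s\<close> and \<open>w\<^sub>i = 1 / g\<^sub>i\<close>, the quotient \<open>deg\<^sub>i(s) / g\<^sub>s\<close> is a martingale that starts at
  \<open>m w\<^sub>i\<close>.  Hence the expected number of edges from \<open>t\<close> to an older vertex \<open>i\<close> is about
  \<open>m g\<^sub>t w\<^sub>i / x\<^sub>t\<close>, and \<open>m g\<^sub>t\<^sup>2\<close> is close to \<open>x\<^sub>t\<close>: the expected adjacency matrix is close to the
  rank one matrix with entries \<open>w\<^sub>i w\<^sub>t\<close>.  Its nonzero eigenvalue is the sum of the \<open>w\<^sub>i\<^sup>2\<close>; here
  \<open>w\<^sub>i\<^sup>2\<close> is about \<open>m / (2 i - m)\<close> for \<open>i > m\<close> and is \<open>1\<close> for \<open>i \<le> m\<close>, which adds up to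
  \<open>m + (m / 2) ln ((2 n - m) / m) + O(1) = \<alpha>(c) n + O(1)\<close>.

  The random fluctuation of the matrix is not treated in operator norm.  The adjacency matrix \<open>M\<close> is
  symmetric and nonnegative and \<open>w\<close> is positive, so by the two-sided Collatz--Wielandt bound
  (\<open>lambda_max_Collatz_Wielandt\<close>) it suffices that every quotient \<open>(M w)\<^sub>i / w\<^sub>i\<close> is within \<open>o(n)\<close> of
  \<open>\<alpha>(c) n\<close>.  The weights are bounded below by a constant, so only the row sums \<open>(M w)\<^sub>i\<close> matter, and
  those are linear functionals of the graph:

  \<^item> the edges from \<open>i\<close> to younger vertices \<open>t\<close> are the increments of \<open>deg\<^sub>i\<close>, and a summation by parts
    turns their weighted sum into a function of the degrees \<open>deg\<^sub>i(t)\<close> alone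
    (\<open>forward_row_telescope\<close>);
  \<^item> the edges from \<open>i\<close> to older vertices come from \<open>m\<close> independent draws, whose mean is again a function
    of the degrees.

  Since \<open>m\<close> is proportional to \<open>n\<close>, the degrees are of order \<open>n\<close>, and an exponential supermartingale
  (\<open>normalized_degree_mgf\<close>) shows that each of them deviates by \<open>\<delta> n\<close> only with exponentially small
  probability; the same holds for each batch of draws (\<open>new_row_mgf\<close>).  A union bound over
  \<open>O(n\<^sup>2)\<close> events (\<open>prob_not_typical\<close>) leaves a deterministic estimate (\<open>row_sum_approx\<close>) on the
  remaining graphs.
\<close>

section \<open>Eigenvalue bounds from an approximate positive eigenvector\<close>

text \<open>
  The sphere in coordinates \<open>0, \<dots>, n - 1\<close> is realised inside \<open>nat \<Rightarrow> real\<close>, so that the dimension stays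
  a variable; it is a closed subset of a product of intervals, which is compact by Tychonoff.
\<close>
lemma compact_unit_sphere_coords:
  "compact {x :: nat \<Rightarrow> real. (\<Sum>i<n. (x i)\<^sup>2) = 1 \<and> (\<forall>i\<ge>n. x i = 0)}"
proof -
  let ?K = "{x :: nat \<Rightarrow> real. (\<Sum>i<n. (x i)\<^sup>2) = 1 \<and> (\<forall>i\<ge>n. x i = 0)}"
  let ?B = "PiE UNIV (\<lambda>_::nat. {-1..1::real})"
  have "compactin (product_topology (\<lambda>_. euclidean) UNIV) ?B"
    by (subst compactin_PiE) (auto simp: compactin_euclidean_iff)
  then have "compact ?B"
    by (simp add: euclidean_product_topology compactin_euclidean_iff)
  moreover have "closed ?K"
  proof -
    have "continuous_on UNIV (\<lambda>x :: nat \<Rightarrow> real. \<Sum>i<n. (x i)\<^sup>2)"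
      by (intro continuous_intros continuous_on_product_coordinates)
    then have 1: "closed {x :: nat \<Rightarrow> real. (\<Sum>i<n. (x i)\<^sup>2) = 1}"
      by (intro closed_Collect_eq) auto
    have "closed {x :: nat \<Rightarrow> real. x i = 0}" for i
      by (intro closed_Collect_eq) auto
    then have 2: "closed (\<Inter>i\<in>{n..}. {x :: nat \<Rightarrow> real. x i = 0})" by auto
    have "?K = {x. (\<Sum>i<n. (x i)\<^sup>2) = 1} \<inter> (\<Inter>i\<in>{n..}. {x. x i = 0})" by auto
    then show ?thesis using 1 2 by auto
  qed
  moreover have "?K \<subseteq> ?B"
  proof
    fix x assume x: "x \<in> ?K"
    have "\<bar>x i\<bar> \<le> 1" for i
    proof (cases "i < n")
      case True
      then have "(x i)\<^sup>2 \<le> (\<Sum>i<n. (x i)\<^sup>2)"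
        by (intro member_le_sum) auto
      then show ?thesis using x by (simp add: abs_square_le_1)
    qed (use x in auto)
    then have "x i \<in> {-1..1}" for i by (auto simp: abs_le_iff minus_le_iff)
    then show "x \<in> ?B" by auto
  qed
  then have "?B \<inter> ?K = ?K" by (rule Int_absorb1)
  ultimately show ?thesis using compact_Int_closed[of ?B ?K] by (simp only:)
qed

definition quad_form :: "nat \<Rightarrow> (nat \<Rightarrow> nat \<Rightarrow> real) \<Rightarrow> (nat \<Rightarrow> real) \<Rightarrow> real" where
  "quad_form n a w = (\<Sum>i<n. w i * (\<Sum>j<n. a i j * w j))"

lemma quad_form_add_scaled:
  assumes "\<And>i j. i < n \<Longrightarrow> j < n \<Longrightarrow> a i j = a j i"
  shows "quad_form n a (\<lambda>i. x i + t * y i) =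
           quad_form n a x + 2 * t * (\<Sum>i<n. y i * (\<Sum>j<n. a i j * x j)) + t\<^sup>2 * quad_form n a y"
proof -
  have "(\<Sum>i<n. x i * (\<Sum>j<n. a i j * y j)) = (\<Sum>i<n. \<Sum>j<n. x i * (a i j * y j))"
    by (simp add: sum_distrib_left)
  also have "\<dots> = (\<Sum>j<n. \<Sum>i<n. x i * (a i j * y j))" by (rule sum.swap)
  also have "\<dots> = (\<Sum>j<n. \<Sum>i<n. y j * (a j i * x i))"
    by (intro sum.cong refl) (simp add: assms)
  also have "\<dots> = (\<Sum>i<n. y i * (\<Sum>j<n. a i j * x j))"
    by (simp add: sum_distrib_left)
  finally have cross: "(\<Sum>i<n. x i * (\<Sum>j<n. a i j * y j)) = (\<Sum>i<n. y i * (\<Sum>j<n. a i j * x j))" .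
  have "quad_form n a (\<lambda>i. x i + t * y i) =
        quad_form n a x + t * (\<Sum>i<n. x i * (\<Sum>j<n. a i j * y j))
          + t * (\<Sum>i<n. y i * (\<Sum>j<n. a i j * x j)) + t\<^sup>2 * quad_form n a y"
    unfolding quad_form_def
    by (simp add: algebra_simps sum.distrib sum_distrib_left power2_eq_square)
  then show ?thesis using cross by simp
qed

text \<open>
  First-order condition at a maximum: a quadratic without constant term that stays nonpositive has no
  linear term.
\<close>
lemma linear_coefficient_zero:
  fixes p q :: real
  assumes "\<And>t. 2 * t * p + t\<^sup>2 * q \<le> 0"
  shows "p = 0"
proof (rule ccontr)
  assume p: "p \<noteq> 0"
  \<comment> \<open>With this step the linear term dominates: \<open>t p \<ge> t\<^sup>2 \<bar>q\<bar>\<close>.\<close>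
  define t where "t = p / (\<bar>q\<bar> + 1)"
  have "t\<^sup>2 * \<bar>q\<bar> \<le> t\<^sup>2 * (\<bar>q\<bar> + 1)" by (intro mult_left_mono) auto
  also have "\<dots> = t * p" by (simp add: t_def power2_eq_square)
  finally have "t\<^sup>2 * \<bar>q\<bar> \<le> t * p" .
  moreover have "t\<^sup>2 * q \<ge> - (t\<^sup>2 * \<bar>q\<bar>)"
    using mult_left_mono[of "- \<bar>q\<bar>" q "t\<^sup>2"] by (simp add: abs_if)
  moreover have "t * p = p\<^sup>2 / (\<bar>q\<bar> + 1)" by (simp add: t_def power2_eq_square)
  then have "t * p > 0" using p by (simp add: add_nonneg_pos)
  ultimately show False using assms[of t] by linarith
qed

text \<open>
  The maximum of the quadratic form on the unit sphere is attained by compactness.  At a maximiser \<open>x\<close>,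
  varying \<open>x\<close> in each coordinate direction and applying \<open>linear_coefficient_zero\<close> gives the eigenvector
  equation.
\<close>
lemma symmetric_Rayleigh_eigenvector:
  fixes a :: "nat \<Rightarrow> nat \<Rightarrow> real"
  assumes sym: "\<And>i j. i < n \<Longrightarrow> j < n \<Longrightarrow> a i j = a j i" and "n > 0"
  shows "\<exists>\<mu> x. (\<exists>i<n. x i \<noteq> 0) \<and> (\<forall>i<n. (\<Sum>j<n. a i j * x j) = \<mu> * x i) \<and>
           (\<forall>w. quad_form n a w \<le> \<mu> * (\<Sum>i<n. (w i)\<^sup>2))"
proof -
  define K where "K = {x :: nat \<Rightarrow> real. (\<Sum>i<n. (x i)\<^sup>2) = 1 \<and> (\<forall>i\<ge>n. x i = 0)}"
  have "(\<lambda>i. if i = 0 then 1 else 0) \<in> K"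
  proof -
    have "(\<Sum>i<n. (if i = 0 then 1 else 0 :: real)\<^sup>2) = (\<Sum>i<n. if i = 0 then 1 else 0)"
      by (intro sum.cong) auto
    then show ?thesis using \<open>n > 0\<close> by (simp add: K_def)
  qed
  then have "K \<noteq> {}" by blast
  moreover have "continuous_on K (quad_form n a)"
    unfolding quad_form_def
    by (intro continuous_intros continuous_on_subset[OF continuous_on_product_coordinates]) auto
  ultimately obtain x where x: "x \<in> K" and max: "\<And>w. w \<in> K \<Longrightarrow> quad_form n a w \<le> quad_form n a x"
    using continuous_attains_sup[OF compact_unit_sphere_coords[of n, folded K_def]] by blast
  define \<mu> where "\<mu> = quad_form n a x"
  have bound: "quad_form n a w \<le> \<mu> * (\<Sum>i<n. (w i)\<^sup>2)" for w
  proof (cases "(\<Sum>i<n. (w i)\<^sup>2) = 0")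
    case True
    then have "\<forall>i<n. w i = 0" by (subst (asm) sum_nonneg_eq_0_iff) auto
    then have "quad_form n a w = 0" by (simp add: quad_form_def)
    then show ?thesis using True by simp
  next
    case False
    define S where "S = (\<Sum>i<n. (w i)\<^sup>2)"
    have S: "S > 0" using False by (simp add: S_def less_le sum_nonneg)
    define u where "u = (\<lambda>i. if i < n then w i / sqrt S else 0)"
    have "(\<Sum>i<n. (u i)\<^sup>2) = (\<Sum>i<n. (w i)\<^sup>2 / S)"
      using S by (intro sum.cong) (auto simp: u_def power_divide)
    also have "\<dots> = 1" using S by (simp add: S_def flip: sum_divide_distrib)
    finally have "(\<Sum>i<n. (u i)\<^sup>2) = 1" .
    moreover have "\<forall>i\<ge>n. u i = 0" by (simp add: u_def)
    ultimately have "u \<in> K" by (simp add: K_def)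
    then have "quad_form n a u \<le> \<mu>" using max by (simp add: \<mu>_def)
    moreover have "quad_form n a u = quad_form n a w / S"
    proof -
      have "quad_form n a u = (\<Sum>i<n. w i * (\<Sum>j<n. a i j * w j) / S)"
        unfolding quad_form_def
      proof (intro sum.cong refl)
        fix i assume "i \<in> {..<n}"
        have "(\<Sum>j<n. a i j * u j) = (\<Sum>j<n. a i j * w j) / sqrt S"
          unfolding sum_divide_distrib by (intro sum.cong) (auto simp: u_def)
        then show "u i * (\<Sum>j<n. a i j * u j) = w i * (\<Sum>j<n. a i j * w j) / S"
          using \<open>i \<in> _\<close> S by (simp add: u_def)
      qed
      then show ?thesis by (simp add: quad_form_def sum_divide_distrib)
    qed
    ultimately show ?thesis using S by (simp add: S_def field_simps)
  qed
  have eig: "(\<Sum>j<n. a i j * x j) = \<mu> * x i" if i: "i < n" for i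
  proof -
    let ?y = "\<lambda>k. if k = i then 1 else 0 :: real"
    have y: "(\<Sum>k<n. ?y k * f k) = f i" for f
    proof -
      have "(\<Sum>k<n. ?y k * f k) = (\<Sum>k<n. if k = i then f k else 0)" by (intro sum.cong) auto
      then show ?thesis using i by simp
    qed
    have "2 * t * ((\<Sum>j<n. a i j * x j) - \<mu> * x i) + t\<^sup>2 * (quad_form n a ?y - \<mu>) \<le> 0" for t
    proof -
      have "(\<Sum>k<n. (x k + t * ?y k)\<^sup>2) = (\<Sum>k<n. (x k)\<^sup>2) + 2 * t * (\<Sum>k<n. ?y k * x k) + t\<^sup>2 * (\<Sum>k<n. ?y k * ?y k)"
        by (simp only: power2_eq_square sum_distrib_left flip: sum.distrib)
           (intro sum.cong refl, simp add: algebra_simps)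
      also have "\<dots> = 1 + 2 * t * x i + t\<^sup>2" using x by (simp add: y K_def del: mult_zero_left)
      finally have "(\<Sum>k<n. (x k + t * ?y k)\<^sup>2) = 1 + 2 * t * x i + t\<^sup>2" .
      with bound[of "\<lambda>k. x k + t * ?y k"]
      have "quad_form n a x + 2 * t * (\<Sum>j<n. a i j * x j) + t\<^sup>2 * quad_form n a ?y
             \<le> \<mu> * (1 + 2 * t * x i + t\<^sup>2)"
        by (simp only: quad_form_add_scaled[of n a, OF sym] y)
      then show ?thesis by (simp add: \<mu>_def algebra_simps)
    qed
    then show ?thesis using linear_coefficient_zero by fastforce
  qed
  have "\<exists>i<n. x i \<noteq> 0"
  proof (rule ccontr)
    assume "\<not> (\<exists>i<n. x i \<noteq> 0)"
    then have "(\<Sum>i<n. (x i)\<^sup>2) = 0" by simp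
    then show False using x by (simp add: K_def)
  qed
  then show ?thesis using eig bound by blast
qed

lemma mult_mat_vec_index_sum:
  assumes "A \<in> carrier_mat n n" "w \<in> carrier_vec n" "i < n"
  shows "(A *\<^sub>v w) $ i = (\<Sum>j<n. A $$ (i, j) * w $ j)"
  using assms by (simp add: scalar_prod_def lessThan_atLeast0 row_def)

text \<open>
  From below, the quadratic form at \<open>v\<close> is at least \<open>(L - d) \<bar>v\<bar>\<^sup>2\<close>, so the Rayleigh maximum, which is an
  eigenvalue, is at least \<open>L - d\<close>.  From above, given an eigenvector \<open>w\<close>, look at a coordinate \<open>k\<close> where
  \<open>\<bar>w\<^sub>k\<bar> / v\<^sub>k\<close> is maximal: by nonnegativity of \<open>A\<close>, replacing \<open>w\<close> by \<open>v\<close> scaled to this maximum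
  can only increase the right-hand side of the \<open>k\<close>-th eigenvector equation.
\<close>
theorem lambda_max_Collatz_Wielandt:
  fixes A :: "real mat" and v :: "nat \<Rightarrow> real"
  assumes A: "A \<in> carrier_mat n n" and "n > 0"
    and sym: "\<And>i j. i < n \<Longrightarrow> j < n \<Longrightarrow> A $$ (i, j) = A $$ (j, i)"
    and nonneg: "\<And>i j. i < n \<Longrightarrow> j < n \<Longrightarrow> A $$ (i, j) \<ge> 0"
    and v: "\<And>i. i < n \<Longrightarrow> v i > 0"
    and approx: "\<And>i. i < n \<Longrightarrow> \<bar>(\<Sum>j<n. A $$ (i, j) * v j) - L * v i\<bar> \<le> d * v i"
  shows "\<bar>lambda_max A - L\<bar> \<le> d"
proof -
  let ?a = "\<lambda>i j. A $$ (i, j)"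
  have fin: "finite (spectrum A)" by (rule card_finite_spectrum[OF A])
  have lower: "\<exists>\<mu>\<in>spectrum A. L - d \<le> \<mu>"
  proof -
    obtain \<mu> x where x: "\<exists>i<n. x i \<noteq> 0" "\<And>i. i < n \<Longrightarrow> (\<Sum>j<n. ?a i j * x j) = \<mu> * x i"
      and R: "\<And>w. quad_form n ?a w \<le> \<mu> * (\<Sum>i<n. (w i)\<^sup>2)"
      using symmetric_Rayleigh_eigenvector[of n ?a, OF sym \<open>n > 0\<close>] by blast
    have "eigenvector A (vec n x) \<mu>"
      unfolding eigenvector_def
    proof (intro conjI)
      show "vec n x \<noteq> 0\<^sub>v (dim_row A)"
      proof
        assume "vec n x = 0\<^sub>v (dim_row A)"
        moreover obtain i where "i < n" "x i \<noteq> 0" using x(1) by blast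
        ultimately show False using A index_vec[of i n x] by simp
      qed
      show "A *\<^sub>v vec n x = \<mu> \<cdot>\<^sub>v vec n x"
        using A x(2) by (intro eq_vecI) (auto simp: mult_mat_vec_index_sum simp del: index_mult_mat_vec)
    qed (use A in auto)
    then have "\<mu> \<in> spectrum A" by (auto simp: spectrum_def eigenvalue_def)
    moreover have "L - d \<le> \<mu>"
    proof -
      have pos: "(\<Sum>i<n. (v i)\<^sup>2) > 0"
        using v \<open>n > 0\<close> by (intro sum_pos zero_less_power) auto
      have "(L - d) * (\<Sum>i<n. (v i)\<^sup>2) = (\<Sum>i<n. v i * ((L - d) * v i))"
        by (simp add: sum_distrib_left power2_eq_square algebra_simps)
      also have "\<dots> \<le> quad_form n ?a v"
        unfolding quad_form_def
      proof (intro sum_mono mult_left_mono)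
        fix i assume "i \<in> {..<n}"
        then show "(L - d) * v i \<le> (\<Sum>j<n. ?a i j * v j)" "0 \<le> v i"
          using approx[of i] v[of i] by (auto simp: algebra_simps abs_le_iff)
      qed
      also have "\<dots> \<le> \<mu> * (\<Sum>i<n. (v i)\<^sup>2)" by (rule R)
      finally show ?thesis using pos by simp
    qed
    ultimately show ?thesis by blast
  qed
  have upper: "\<mu> \<le> L + d" if "\<mu> \<in> spectrum A" for \<mu>
  proof -
    from that obtain w where w: "w \<in> carrier_vec n" "w \<noteq> 0\<^sub>v n" "A *\<^sub>v w = \<mu> \<cdot>\<^sub>v w"
      using A by (auto simp: spectrum_def eigenvalue_def eigenvector_def)
    have ex: "\<exists>i<n. w $ i \<noteq> 0"
    proof (rule ccontr)
      assume "\<not> ?thesis"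
      then have "w = 0\<^sub>v n" using w(1) by (intro eq_vecI) auto
      then show False using w(2) by simp
    qed
    define r where "r = Max ((\<lambda>i. \<bar>w $ i\<bar> / v i) ` {..<n})"
    have r: "\<bar>w $ i\<bar> \<le> r * v i" if "i < n" for i
    proof -
      have "\<bar>w $ i\<bar> / v i \<le> r" unfolding r_def using that by (intro Max_ge) auto
      then show ?thesis using v[OF that] by (simp add: field_simps)
    qed
    have "r \<in> (\<lambda>i. \<bar>w $ i\<bar> / v i) ` {..<n}"
      unfolding r_def using \<open>n > 0\<close> by (intro Max_in) auto
    then obtain k where k: "k < n" "\<bar>w $ k\<bar> = r * v k"
      using v by (auto simp: less_imp_neq[THEN not_sym])
    have "r > 0"
    proof -
      obtain i where "i < n" "w $ i \<noteq> 0" using ex by blast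
      then have "0 < r * v i" using r[of i] by linarith
      then show ?thesis using v[OF \<open>i < n\<close>] by (simp add: zero_less_mult_iff)
    qed
    have "\<mu> * (r * v k) \<le> \<bar>\<mu> * w $ k\<bar>" 
      unfolding abs_mult k(2) using \<open>r > 0\<close> v[OF k(1)] by (intro mult_right_mono) auto
    also have "\<mu> * w $ k = (\<Sum>j<n. ?a k j * w $ j)"
      using mult_mat_vec_index_sum[OF A w(1) k(1)] w(1,3) k(1) by simp
    also have "\<bar>\<dots>\<bar> \<le> (\<Sum>j<n. ?a k j * (r * v j))"
      using k(1) r nonneg by (intro order.trans[OF sum_abs] sum_mono) (auto simp: abs_mult intro!: mult_left_mono)
    also have "\<dots> = r * (\<Sum>j<n. ?a k j * v j)" by (simp add: sum_distrib_left algebra_simps)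
    also have "\<dots> \<le> r * ((L + d) * v k)"
      using approx[OF k(1)] \<open>r > 0\<close> by (intro mult_left_mono) (auto simp: algebra_simps abs_le_iff)
    finally have "\<mu> * (r * v k) \<le> (L + d) * (r * v k)" by (simp add: algebra_simps)
    then show ?thesis using v[OF k(1)] \<open>r > 0\<close> by simp
  qed
  have "lambda_max A \<in> spectrum A" unfolding lambda_max_def using lower fin by (intro Max_in) auto
  moreover have "L - d \<le> lambda_max A"
    unfolding lambda_max_def using lower fin by (meson Max_ge order.trans)
  ultimately show ?thesis using upper by (fastforce simp: abs_le_iff)
qed

section \<open>The profile of expected degrees\<close>

text \<open>
  The total degree of the graph at time \<open>s \<ge> m + 1\<close>, divided by \<open>m\<close> (see \<open>total_deg_eq\<close>).
\<close>
definition norm_total_deg :: "nat \<Rightarrow> nat \<Rightarrow> real" where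
  "norm_total_deg m s = 2 * real s - real m - 1"

text \<open>
  The conditional mean of the degree of an existing vertex is multiplied by \<open>1 + 1 / x\<^sub>r\<close> in the step from
  \<open>r\<close> to \<open>r + 1\<close>.  The product is empty for \<open>s \<le> m + 1\<close>, so that all vertices of the initial complete graph
  have weight \<open>1\<close>.
\<close>
definition growth :: "nat \<Rightarrow> nat \<Rightarrow> real" where
  "growth m s = (\<Prod>r\<in>{m+1..<s}. 1 + 1 / norm_total_deg m r)"

definition weight :: "nat \<Rightarrow> nat \<Rightarrow> real" where
  "weight m i = 1 / growth m i"

lemma norm_total_deg_ge: "m + 1 \<le> s \<Longrightarrow> real m + 1 \<le> norm_total_deg m s"
  by (simp add: norm_total_deg_def)

lemma norm_total_deg_Suc: "norm_total_deg m (Suc s) = norm_total_deg m s + 2"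
  by (simp add: norm_total_deg_def)

lemma growth_initial: "s \<le> m + 1 \<Longrightarrow> growth m s = 1"
  by (simp add: growth_def)

lemma growth_Suc: "m + 1 \<le> s \<Longrightarrow> growth m (Suc s) = growth m s * (1 + 1 / norm_total_deg m s)"
  by (simp add: growth_def)

lemma growth_ge_1: "growth m s \<ge> 1"
  unfolding growth_def
proof (rule prod_ge_1)
  fix r assume "r \<in> {m+1..<s}"
  then have "norm_total_deg m r > 0" using norm_total_deg_ge[of m r] by simp
  then show "1 \<le> 1 + 1 / norm_total_deg m r" by simp
qed

lemma growth_pos: "growth m s > 0"
  using growth_ge_1[of m s] by linarith

lemma weight_pos: "weight m i > 0"
  by (simp add: weight_def growth_pos)

lemma weight_le_1: "weight m i \<le> 1"
  by (simp add: weight_def growth_pos growth_ge_1 divide_le_eq_1)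

text \<open>
  Both bounds on \<open>growth\<^sup>2\<close> telescope: with \<open>x = norm_total_deg m s\<close> one has
  \<open>(x + 2) / x \<le> (1 + 1 / x)\<^sup>2 \<le> (x + 1) / (x - 1)\<close>, and \<open>x\<close> increases by \<open>2\<close> in each step.
\<close>
lemma growth_squared_lower:
  assumes "m + 1 \<le> s"
  shows "norm_total_deg m s / (real m + 1) \<le> (growth m s)\<^sup>2"
  using assms
proof (induction s rule: dec_induct)
  case base
  then show ?case by (simp add: growth_initial norm_total_deg_def)
next
  case (step s)
  define x where "x = norm_total_deg m s"
  have x: "x > 0" using norm_total_deg_ge[of m s] step.hyps by (simp add: x_def)
  have "x + 2 \<le> x * (1 + 1 / x)\<^sup>2"
    using x by (simp add: field_simps power2_eq_square)
  then have "(x + 2) / (real m + 1) \<le> x / (real m + 1) * (1 + 1 / x)\<^sup>2"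
    by (simp add: divide_right_mono)
  also have "\<dots> \<le> (growth m s)\<^sup>2 * (1 + 1 / x)\<^sup>2"
    using step.IH by (intro mult_right_mono) (auto simp: x_def)
  finally show ?case
    using step.hyps by (simp add: growth_Suc norm_total_deg_Suc power_mult_distrib x_def)
qed

lemma growth_squared_upper:
  assumes "m + 1 \<le> s" "m \<ge> 1"
  shows "(growth m s)\<^sup>2 \<le> (norm_total_deg m s - 1) / real m"
  using assms(1)
proof (induction s rule: dec_induct)
  case base
  then show ?case using assms(2) by (simp add: growth_initial norm_total_deg_def)
next
  case (step s)
  define x where "x = norm_total_deg m s"
  have x: "x > 0" using norm_total_deg_ge[of m s] step.hyps by (simp add: x_def)
  have "(growth m s)\<^sup>2 * (1 + 1 / x)\<^sup>2 \<le> (x - 1) / real m * (1 + 1 / x)\<^sup>2"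
    using step.IH by (intro mult_right_mono) (auto simp: x_def)
  also have "\<dots> = (x - 1) * (x + 1)\<^sup>2 / x\<^sup>2 / real m"
    using x by (simp add: field_simps power2_eq_square)
  also have "(x - 1) * (x + 1)\<^sup>2 / x\<^sup>2 \<le> x + 1"
    using x by (simp add: field_simps power2_eq_square)
  finally show ?case
    using step.hyps by (simp add: growth_Suc norm_total_deg_Suc power_mult_distrib x_def divide_right_mono add.commute)
qed

lemma weight_squared_lower:
  assumes "m + 1 \<le> s" "m \<ge> 1"
  shows "real m / (norm_total_deg m s - 1) \<le> (weight m s)\<^sup>2"
proof -
  have "inverse ((norm_total_deg m s - 1) / real m) \<le> inverse ((growth m s)\<^sup>2)"
    using growth_squared_upper[OF assms] growth_pos[of m s] by (intro le_imp_inverse_le) auto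
  then show ?thesis by (simp add: weight_def power_divide inverse_eq_divide)
qed

lemma weight_squared_upper:
  assumes "m + 1 \<le> s"
  shows "(weight m s)\<^sup>2 \<le> (real m + 1) / norm_total_deg m s"
proof -
  have "inverse ((growth m s)\<^sup>2) \<le> inverse (norm_total_deg m s / (real m + 1))"
    using growth_squared_lower[OF assms] norm_total_deg_ge[OF assms] by (intro le_imp_inverse_le) auto
  then show ?thesis by (simp add: weight_def power_divide inverse_eq_divide)
qed

lemma weight_squared_approx:
  assumes "m + 1 \<le> s" "m \<ge> 1"
  shows "\<bar>(weight m s)\<^sup>2 - real m / (norm_total_deg m s + 1)\<bar> \<le> 2 / real m"
proof -
  define x where "x = norm_total_deg m s"
  have x: "real m + 1 \<le> x" using norm_total_deg_ge[OF assms(1)] by (simp add: x_def)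
  have m: "real m \<ge> 1" using assms(2) by simp
  have "real m / (x + 1) \<le> real m / (x - 1)" using x m by (intro divide_left_mono) auto
  also have "\<dots> \<le> (weight m s)\<^sup>2" using weight_squared_lower[OF assms] by (simp add: x_def)
  finally have lo: "real m / (x + 1) \<le> (weight m s)\<^sup>2" .
  have "(real m + 1) / x - real m / (x + 1) = (real m + 1 + x) / (x * (x + 1))"
    using x m by (simp add: field_simps)
  also have "\<dots> \<le> (2 * x) / (x * (x + 1))" using x m by (intro divide_right_mono) auto
  also have "\<dots> = 2 / (x + 1)" using x m by simp
  also have "\<dots> \<le> 2 / real m" using x m by (intro divide_left_mono) auto
  finally have "(weight m s)\<^sup>2 - real m / (x + 1) \<le> 2 / real m"
    using weight_squared_upper[OF assms(1)] by (simp add: x_def)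
  with lo show ?thesis by (simp add: x_def)
qed

text \<open>
  The squared weights are compared with \<open>m / (x\<^sub>t + 1) = m / (2 t - m)\<close> because exactly these terms appear in
  the summation by parts \<open>forward_row_telescope\<close>.
\<close>
lemma sum_weight_squared_approx:
  assumes "m \<le> s" "m \<ge> 1"
  shows "\<bar>(\<Sum>j\<in>{1..s}. (weight m j)\<^sup>2) - (real m + real m * (\<Sum>t\<in>{m+1..<Suc s}. 1 / (norm_total_deg m t + 1)))\<bar>
           \<le> 2 * (real s - real m) / real m"
  using assms(1)
proof (induction s rule: dec_induct)
  case base
  have "(\<Sum>j\<in>{1..m}. (weight m j)\<^sup>2) = (\<Sum>j\<in>{1..m}. 1)"
    by (intro sum.cong) (auto simp: weight_def growth_initial)
  then show ?case by simp
next
  case (step s)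
  let ?e = "2 * (real s - real m) / real m"
  have "2 * (real (Suc s) - real m) / real m = ?e + 2 / real m"
    unfolding add_divide_distrib[symmetric] by simp
  then show ?case
    using step weight_squared_approx[of m "Suc s"] assms(2)
    by (simp add: algebra_simps abs_le_iff)
qed

text \<open>
  Comparison with an integral, done by telescoping logarithms: \<open>1 / y\<close> lies between
  \<open>(ln (y + 2) - ln y) / 2\<close> and \<open>(ln y - ln (y - 2)) / 2\<close> for \<open>y = 2 t - m\<close>.
\<close>
lemma harmonic_sum_bounds:
  assumes "m + 1 \<le> n" "m \<ge> 1"
  shows "ln ((2 * real n - real m) / (real m + 2)) / 2 \<le> (\<Sum>t\<in>{m+1..<n}. 1 / (norm_total_deg m t + 1))"
    and "(\<Sum>t\<in>{m+1..<n}. 1 / (norm_total_deg m t + 1)) \<le> ln ((2 * real n - real m - 2) / real m) / 2"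
proof -
  show "ln ((2 * real n - real m) / (real m + 2)) / 2 \<le> (\<Sum>t\<in>{m+1..<n}. 1 / (norm_total_deg m t + 1))"
    using assms(1)
  proof (induction n rule: dec_induct)
    case base
    then show ?case by simp
  next
    case (step n)
    define y where "y = 2 * real n - real m"
    have y: "y > 2" using step.hyps assms(2) by (simp add: y_def)
    have "ln ((y + 2) / (real m + 2)) = ln (y / (real m + 2)) + ln (1 + 2 / y)"
    proof -
      have "1 + 2 / y = (y + 2) / y" using y by (simp add: field_simps)
      then show ?thesis using y by (simp add: ln_divide_pos del: ln_div)
    qed
    also have "ln (1 + 2 / y) \<le> 2 / y" using y by (intro ln_add_one_self_le_self) auto
    finally show ?case using step by (simp add: y_def norm_total_deg_def algebra_simps)
  qed
  show "(\<Sum>t\<in>{m+1..<n}. 1 / (norm_total_deg m t + 1)) \<le> ln ((2 * real n - real m - 2) / real m) / 2"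
    using assms(1)
  proof (induction n rule: dec_induct)
    case base
    then show ?case using assms(2) by simp
  next
    case (step n)
    define y where "y = 2 * real n - real m"
    have y: "y > 2" using step.hyps assms(2) by (simp add: y_def)
    have "ln ((y - 2) / real m) = ln (y / real m) + ln (1 - 2 / y)"
    proof -
      have "1 - 2 / y = (y - 2) / y" using y by (simp add: field_simps)
      then show ?thesis using y assms(2) by (simp add: ln_divide_pos del: ln_div)
    qed
    also have "ln (1 - 2 / y) \<le> - (2 / y)"
      using y ln_le_minus_one[of "1 - 2 / y"] by simp
    finally show ?case using step by (simp add: y_def norm_total_deg_def algebra_simps)
  qed
qed

text \<open>
  The limit of a row sum divided by its weight has two parts: squared weights of the older vertices and the
  terms \<open>m / (x\<^sub>t + 1)\<close> of the younger ones.  Their sum is independent of the cut \<open>s\<close> up to a bounded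
  error, which is why \<open>weight m\<close> is an approximate eigenvector.
\<close>
lemma weight_norm_approx:
  assumes "m \<le> s" "s < n" "m \<ge> 1"
  shows "\<bar>(\<Sum>j\<in>{1..s}. (weight m j)\<^sup>2) + real m * (\<Sum>t\<in>{Suc s..<n}. 1 / (norm_total_deg m t + 1))
            - (real m + real m / 2 * ln ((2 * real n - real m) / real m))\<bar>
           \<le> 2 * real n / real m + 1"
proof -
  let ?h = "\<lambda>t. 1 / (norm_total_deg m t + 1)"
  let ?y = "2 * real n - real m"
  have m: "real m \<ge> 1" and n: "m + 1 \<le> n" using assms by auto
  have y: "?y \<ge> real m + 2" using n by simp
  have split: "sum ?h {m+1..<Suc s} + sum ?h {Suc s..<n} = sum ?h {m+1..<n}"
    using assms by (intro sum.atLeastLessThan_concat) auto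
  have "2 * (real s - real m) / real m \<le> 2 * real n / real m"
    using assms by (intro divide_right_mono) auto
  then have 1: "\<bar>(\<Sum>j\<in>{1..s}. (weight m j)\<^sup>2) + real m * sum ?h {Suc s..<n}
              - (real m + real m * sum ?h {m+1..<n})\<bar> \<le> 2 * real n / real m"
    using sum_weight_squared_approx[OF assms(1,3)] unfolding split[symmetric] distrib_left by linarith
  have "sum ?h {m+1..<n} \<le> ln (?y / real m) / 2"
  proof -
    have "ln ((?y - 2) / real m) \<le> ln (?y / real m)"
      using y m by (subst ln_le_cancel_iff) (auto simp: divide_right_mono)
    then show ?thesis using harmonic_sum_bounds(2)[OF n assms(3)] by linarith
  qed
  then have up: "real m * sum ?h {m+1..<n} \<le> real m / 2 * ln (?y / real m)"
    using m by (simp add: mult_left_mono field_simps)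
  have "ln (?y / real m) = ln (?y / (real m + 2)) + ln (1 + 2 / real m)"
  proof -
    have "1 + 2 / real m = (real m + 2) / real m" using m by (simp add: field_simps)
    then show ?thesis using y m by (simp add: ln_divide_pos del: ln_div)
  qed
  moreover have "ln (1 + 2 / real m) \<le> 2 / real m" using m by (intro ln_add_one_self_le_self) auto
  ultimately have "ln (?y / real m) / 2 - 1 / real m \<le> sum ?h {m+1..<n}"
    using harmonic_sum_bounds(1)[OF n assms(3)] by (simp add: field_simps)
  then have "real m * (ln (?y / real m) / 2 - 1 / real m) \<le> real m * sum ?h {m+1..<n}"
    by (intro mult_left_mono) auto
  then have "real m / 2 * ln (?y / real m) - 1 \<le> real m * sum ?h {m+1..<n}"
    using m by (simp add: right_diff_distrib)
  with up 1 show ?thesis by (simp add: abs_le_iff)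
qed

section \<open>Exponential moments\<close>

text \<open>
  For negative \<open>x = - y\<close> this is the reciprocal of \<open>exp y \<ge> 1 + y + y\<^sup>2 / 2\<close>, since
  \<open>(1 + y + y\<^sup>2 / 2) (1 - y + y\<^sup>2) \<ge> 1\<close>.
\<close>
lemma exp_le_quadratic:
  fixes x :: real
  assumes "\<bar>x\<bar> \<le> 1"
  shows "exp x \<le> 1 + x + x\<^sup>2"
proof (cases "x \<ge> 0")
  case True
  then show ?thesis using assms by (intro exp_bound) auto
next
  case False
  define y where "y = - x"
  have y: "y \<ge> 0" using False by (simp add: y_def)
  have "1 \<le> 1 + y\<^sup>2 / 2 + y ^ 3 / 2 + y ^ 4 / 2" using y by simp
  also have "\<dots> = (1 + y + y\<^sup>2 / 2) * (1 - y + y\<^sup>2)"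
    by (simp add: field_simps power2_eq_square power3_eq_cube power4_eq_xxxx)
  also have "\<dots> \<le> exp y * (1 - y + y\<^sup>2)"
  proof (rule mult_right_mono)
    have "0 \<le> (1/2 - y)\<^sup>2" by simp
    then show "0 \<le> 1 - y + y\<^sup>2" by (simp add: power2_eq_square algebra_simps)
  qed (rule exp_lower_Taylor_quadratic[OF y])
  finally have "exp x \<le> exp x * (exp y * (1 - y + y\<^sup>2))" by simp
  also have "\<dots> = 1 + x + x\<^sup>2" by (simp add: y_def exp_minus)
  finally show ?thesis .
qed

lemma pmf_two_sided_Chernoff:
  fixes X :: "'a \<Rightarrow> real"
  assumes "\<And>\<sigma>. \<bar>\<sigma>\<bar> = \<eta> \<Longrightarrow> (\<integral>\<^sup>+x. ennreal (exp (\<sigma> * X x)) \<partial>measure_pmf p) \<le> ennreal (exp b)"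
    and "\<eta> \<ge> 0"
  shows "measure (measure_pmf p) {x. \<bar>X x\<bar> > a} \<le> 2 * exp (b - \<eta> * a)"
proof -
  have tail: "measure (measure_pmf p) {x. \<sigma> * X x \<ge> \<eta> * a} \<le> exp (b - \<eta> * a)"
    if \<sigma>: "\<bar>\<sigma>\<bar> = \<eta>" for \<sigma>
  proof -
    have "ennreal (measure (measure_pmf p) {x. \<sigma> * X x \<ge> \<eta> * a})
            = (\<integral>\<^sup>+x. indicator {x. \<sigma> * X x \<ge> \<eta> * a} x \<partial>measure_pmf p)"
      by (simp add: measure_pmf.emeasure_eq_measure)
    also have "\<dots> \<le> (\<integral>\<^sup>+x. ennreal (exp (- (\<eta> * a))) * ennreal (exp (\<sigma> * X x)) \<partial>measure_pmf p)"
      by (intro nn_integral_mono) (auto simp: indicator_def simp flip: ennreal_mult exp_add ennreal_1)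
    also have "\<dots> = ennreal (exp (- (\<eta> * a))) * (\<integral>\<^sup>+x. ennreal (exp (\<sigma> * X x)) \<partial>measure_pmf p)"
      by (rule nn_integral_cmult) simp
    also have "\<dots> \<le> ennreal (exp (- (\<eta> * a))) * ennreal (exp b)"
      by (intro mult_left_mono assms(1) \<sigma>) simp
    also have "\<dots> = ennreal (exp (b - \<eta> * a))"
      by (simp add: add.commute flip: ennreal_mult exp_add)
    finally show ?thesis by simp
  qed
  have "measure (measure_pmf p) {x. \<bar>X x\<bar> > a}
          \<le> measure (measure_pmf p) ({x. \<eta> * X x \<ge> \<eta> * a} \<union> {x. (- \<eta>) * X x \<ge> \<eta> * a})"
  proof (rule measure_pmf.finite_measure_mono)
    have "\<eta> * a \<le> \<eta> * X x \<or> \<eta> * a \<le> \<eta> * (- X x)" if "\<bar>X x\<bar> > a" for x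
    proof -
      have "a \<le> X x \<or> a \<le> - X x" using that by linarith
      then show ?thesis using mult_left_mono[OF _ \<open>\<eta> \<ge> 0\<close>] by blast
    qed
    then show "{x. \<bar>X x\<bar> > a} \<subseteq> {x. \<eta> * X x \<ge> \<eta> * a} \<union> {x. (- \<eta>) * X x \<ge> \<eta> * a}"
      by auto
  qed simp
  also have "\<dots> \<le> measure (measure_pmf p) {x. \<eta> * X x \<ge> \<eta> * a}
                  + measure (measure_pmf p) {x. (- \<eta>) * X x \<ge> \<eta> * a}"
    by (rule measure_Un_le) auto
  also have "\<dots> \<le> exp (b - \<eta> * a) + exp (b - \<eta> * a)"
    using \<open>\<eta> \<ge> 0\<close> by (intro add_mono tail) auto
  finally show ?thesis by simp
qed

lemma nn_integral_replicate_pmf_exp: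
  fixes g :: "'a \<Rightarrow> real"
  shows "(\<integral>\<^sup>+xs. ennreal (exp (\<Sum>x\<leftarrow>xs. g x)) \<partial>measure_pmf (replicate_pmf k p))
           = (\<integral>\<^sup>+x. ennreal (exp (g x)) \<partial>measure_pmf p) ^ k"
proof (induction k)
  case 0
  then show ?case by simp
next
  case (Suc k)
  then show ?case
    by (simp add: exp_add ennreal_mult nn_integral_cmult nn_integral_multc)
qed

text \<open>
  One factor per draw: \<open>E exp g \<le> 1 + E (g + g\<^sup>2) \<le> exp (E (g + g\<^sup>2))\<close>.  All concentration below comes from
  this bound, for two choices of \<open>g\<close>: a multiple of the indicator of one vertex, and a multiple of
  \<open>weight m\<close>.
\<close>
lemma preferential_draws_mgf:
  assumes D: "total_deg s G > 0" and g: "\<And>j. j \<in> {1..s} \<Longrightarrow> \<bar>g j\<bar> \<le> 1"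
  shows "(\<integral>\<^sup>+xs. ennreal (exp (\<Sum>x\<leftarrow>xs. g x)) \<partial>measure_pmf (replicate_pmf k (pref_vertex s G)))
           \<le> ennreal (exp (real k * (\<Sum>j\<in>{1..s}. real (deg s G j) * (g j + (g j)\<^sup>2)) / real (total_deg s G)))"
proof -
  let ?p = "\<lambda>j. real (deg s G j) / real (total_deg s G)"
  define S where "S = (\<Sum>j\<in>{1..s}. ?p j * (g j + (g j)\<^sup>2))"
  have total: "(\<Sum>j\<in>{1..s}. ?p j) = 1"
  proof -
    have "(\<Sum>j\<in>{1..s}. ?p j) = real (total_deg s G) / real (total_deg s G)"
      by (simp only: total_deg_def sum_divide_distrib[symmetric] of_nat_sum[symmetric])
    then show ?thesis using D by simp
  qed
  have "(\<integral>\<^sup>+x. ennreal (exp (g x)) \<partial>measure_pmf (pref_vertex s G))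
          = (\<integral>\<^sup>+x. ennreal (exp (g x)) * indicator {1..s} x \<partial>measure_pmf (pref_vertex s G))"
    using set_pref_vertex[OF D] by (intro nn_integral_cong_AE) (auto simp: AE_measure_pmf_iff)
  also have "\<dots> = (\<Sum>x\<in>{1..s}. ennreal (exp (g x)) * indicator {1..s} x * ennreal (pmf (pref_vertex s G) x))"
    by (rule nn_integral_measure_pmf_support) (auto simp: indicator_def)
  also have "\<dots> = (\<Sum>x\<in>{1..s}. ennreal (?p x * exp (g x)))"
    by (intro sum.cong refl) (simp add: pmf_pref_vertex[OF D] mult.commute flip: ennreal_mult)
  also have "\<dots> = ennreal (\<Sum>x\<in>{1..s}. ?p x * exp (g x))"
    by (rule sum_ennreal) auto
  also have "\<dots> \<le> ennreal (exp S)"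
  proof (rule ennreal_leI)
    have "(\<Sum>x\<in>{1..s}. ?p x * exp (g x)) \<le> (\<Sum>x\<in>{1..s}. ?p x * (1 + (g x + (g x)\<^sup>2)))"
      using exp_le_quadratic[OF g] by (intro sum_mono mult_left_mono) (auto simp: add.assoc)
    also have "\<dots> = (\<Sum>x\<in>{1..s}. ?p x) + S" by (simp add: S_def distrib_left sum.distrib)
    also have "\<dots> \<le> exp S" unfolding total by (rule exp_ge_add_one_self)
    finally show "(\<Sum>x\<in>{1..s}. ?p x * exp (g x)) \<le> exp S" .
  qed
  finally have "(\<integral>\<^sup>+x. ennreal (exp (g x)) \<partial>measure_pmf (pref_vertex s G)) ^ k \<le> ennreal (exp S) ^ k"
    by (intro power_mono) auto
  also have "\<dots> = ennreal (exp (real k * S))"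
    by (simp add: ennreal_power exp_of_nat_mult)
  also have "real k * S = real k * (\<Sum>j\<in>{1..s}. real (deg s G j) * (g j + (g j)\<^sup>2)) / real (total_deg s G)"
    by (simp add: S_def sum_divide_distrib sum_distrib_left)
  finally show ?thesis by (simp add: nn_integral_replicate_pmf_exp)
qed

section \<open>The degree process\<close>

lemma deg_add_vertex_old:
  assumes "i \<in> {1..s}"
  shows "deg (Suc s) (add_vertex (Suc s) xs G) i = deg s G i + count_list xs i"
  using assms by (simp add: deg_def add_vertex_def)

lemma deg_add_vertex_new:
  assumes "set xs \<subseteq> {1..s}"
  shows "deg (Suc s) (add_vertex (Suc s) xs G) (Suc s) = length xs"
proof -
  have "count_list xs (Suc s) = 0" using assms by (auto simp: count_list_0_iff)
  then show ?thesis using sum_count_set[OF assms] by (simp add: deg_def add_vertex_def)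
qed

lemma deg_add_vertex_restrict:
  assumes "i \<le> s" "s < t"
  shows "deg s (add_vertex t xs G) i = deg s G i"
  using assms by (auto simp: deg_def add_vertex_def intro!: sum.cong)

lemma deg_complete:
  assumes "j \<in> {1..s}"
  shows "deg s (complete_multigraph s) j = s - 1"
proof -
  have "deg s (complete_multigraph s) j = (\<Sum>k\<in>{1..s} - {j}. 1)"
    unfolding deg_def complete_multigraph_def using assms
    by (intro sum.mono_neutral_cong_right) auto
  then show ?thesis using assms by simp
qed

lemma total_deg_eq:
  assumes "m \<ge> 1" "G \<in> set_pmf (BA_at m k)"
  shows "real (total_deg (m + 1 + k) G) = real m * norm_total_deg m (m + 1 + k)"
proof -
  have "m * (m + 1) \<le> 2 * m * (m + 1 + k)" by (simp add: algebra_simps)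
  then show ?thesis
    unfolding total_deg_BA_at[OF assms] norm_total_deg_def by (simp add: of_nat_diff algebra_simps)
qed

lemma BA_at_SucE:
  assumes "m \<ge> 1" "G \<in> set_pmf (BA_at m (Suc k))"
  obtains H xs where "H \<in> set_pmf (BA_at m k)" "set xs \<subseteq> {1..m + 1 + k}" "length xs = m"
    "G = add_vertex (Suc (m + 1 + k)) xs H"
proof -
  let ?s = "m + 1 + k"
  from assms(2) obtain H xs where H: "H \<in> set_pmf (BA_at m k)"
    and xs: "xs \<in> set_pmf (replicate_pmf m (pref_vertex ?s H))" and G: "G = add_vertex (Suc ?s) xs H"
    by (auto simp: BA_step_def)
  have "real (total_deg ?s H) > 0"
    unfolding total_deg_eq[OF assms(1) H] using assms(1) norm_total_deg_ge[of m ?s] by (intro mult_pos_pos) auto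
  then have "set_pmf (pref_vertex ?s H) \<subseteq> {1..?s}" by (intro set_pref_vertex) simp
  then have "set xs \<subseteq> {1..?s}" "length xs = m"
    using xs by (auto simp: set_replicate_pmf lists_eq_set)
  then show thesis using that H G by blast
qed

text \<open>
  At the first moment \<open>max i (m + 1)\<close> at which \<open>i\<close> is present its degree is deterministic; the martingale of
  vertex \<open>i\<close> starts here.
\<close>
lemma deg_at_birth:
  assumes "m \<ge> 1" "G \<in> set_pmf (BA_at m k)" "1 \<le> i" "max i (m + 1) = m + 1 + k"
  shows "deg (m + 1 + k) G i = m"
proof (cases k)
  case 0
  then show ?thesis using assms deg_complete[of i "m + 1"] by auto
next
  case (Suc k')
  let ?s = "m + 1 + k'"
  have i: "i = Suc ?s" using assms(4) Suc by auto
  from assms(2) obtain H xs where "set xs \<subseteq> {1..?s}" "length xs = m"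
    and G: "G = add_vertex (Suc ?s) xs H"
    unfolding Suc by (rule BA_at_SucE[OF assms(1)])
  then show ?thesis using deg_add_vertex_new[of xs ?s H] by (simp add: G i Suc)
qed

text \<open>
  Later steps do not change the graph on the vertices that are already present, so events about an earlier
  time may be read off the final graph.
\<close>
lemma nn_integral_BA_at_later:
  assumes "\<And>t xs H. m + 1 + k < t \<Longrightarrow> F (add_vertex t xs H) = F H"
  shows "(\<integral>\<^sup>+G. F G \<partial>measure_pmf (BA_at m (k + l))) = (\<integral>\<^sup>+G. F G \<partial>measure_pmf (BA_at m k))"
proof (induction l)
  case (Suc l)
  have "F (add_vertex (m + 1 + Suc (k + l)) xs H) = F H" for xs H
    by (rule assms) simp
  then have "(\<integral>\<^sup>+G. F G \<partial>measure_pmf (BA_step m (m + 1 + Suc (k + l)) H)) = F H" for H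
    by (simp add: BA_step_def)
  then show ?case using Suc by simp
qed simp

lemma BA_at_symmetric_loopless:
  assumes "m \<ge> 1" "G \<in> set_pmf (BA_at m k)"
  shows "G i j = G j i" "G i i = 0"
proof -
  have "(\<forall>i j. G i j = G j i) \<and> (\<forall>i. G i i = 0)"
    using assms(2)
  proof (induction k arbitrary: G)
    case 0
    then show ?case by (auto simp: complete_multigraph_def)
  next
    case (Suc k)
    let ?s = "m + 1 + k"
    from Suc.prems obtain H xs where H: "H \<in> set_pmf (BA_at m k)" and "set xs \<subseteq> {1..?s}"
      and G: "G = add_vertex (Suc ?s) xs H"
      by (rule BA_at_SucE[OF assms(1)])
    then have "count_list xs (Suc ?s) = 0" by (auto simp: count_list_0_iff)
    then show ?case using Suc.IH[OF H] by (simp add: G add_vertex_def)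
  qed
  then show "G i j = G j i" "G i i = 0" by blast+
qed

section \<open>Concentration of degrees and of newly drawn rows\<close>

text \<open>
  The first-order term reproduces \<open>\<phi>\<close> times the normalised degree exactly, by the choice of \<open>growth\<close>.  The
  second-order term is proportional to the degree itself and is therefore absorbed into the coefficient
  instead of being bounded by a constant.
\<close>
lemma normalized_degree_step:
  fixes \<phi> :: real
  assumes "m \<ge> 1" "m + 1 \<le> s" and D: "real (total_deg s G) = real m * norm_total_deg m s"
    and i: "i \<in> {1..s}" and \<phi>: "\<bar>\<phi>\<bar> \<le> 1"
  shows "(\<integral>\<^sup>+H. ennreal (exp (\<phi> * (real (deg (Suc s) H i) / growth m (Suc s)))) \<partial>measure_pmf (BA_step m (Suc s) G))
          \<le> ennreal (exp ((\<phi> + \<phi>\<^sup>2 / norm_total_deg m s) * (real (deg s G i) / growth m s)))"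
proof -
  define x where "x = norm_total_deg m s"
  define y where "y = growth m s"
  define z where "z = growth m (Suc s)"
  define d where "d = real (deg s G i)"
  have x: "x > 0" using norm_total_deg_ge[OF assms(2)] by (simp add: x_def)
  have y: "y \<ge> 1" by (simp add: y_def growth_ge_1)
  have z: "z = y * (1 + 1 / x)" using growth_Suc[OF assms(2)] by (simp add: x_def y_def z_def)
  have zy: "z \<ge> y" using x y by (simp add: z mult_le_cancel_left1)
  have Dpos: "total_deg s G > 0"
  proof -
    have "real (total_deg s G) > 0" unfolding D using assms(1) x by (simp add: x_def)
    then show ?thesis by simp
  qed
  define g where "g = (\<lambda>j. if j = i then \<phi> / z else 0)"
  have g1: "\<bar>g j\<bar> \<le> 1" for j
    using \<phi> y zy by (auto simp: g_def abs_divide divide_le_eq_1)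
  have draws: "(\<Sum>u\<leftarrow>xs. g u) = \<phi> / z * real (count_list xs i)" for xs
    by (induction xs) (auto simp: g_def algebra_simps add_divide_distrib)
  have "(\<integral>\<^sup>+H. ennreal (exp (\<phi> * (real (deg (Suc s) H i) / z))) \<partial>measure_pmf (BA_step m (Suc s) G))
       = (\<integral>\<^sup>+xs. ennreal (exp (\<phi> * d / z)) * ennreal (exp (\<Sum>u\<leftarrow>xs. g u)) \<partial>measure_pmf (replicate_pmf m (pref_vertex s G)))"
    by (simp add: BA_step_def deg_add_vertex_old[OF i] draws d_def add_divide_distrib distrib_left exp_add ennreal_mult)
  also have "\<dots> = ennreal (exp (\<phi> * d / z)) * (\<integral>\<^sup>+xs. ennreal (exp (\<Sum>u\<leftarrow>xs. g u)) \<partial>measure_pmf (replicate_pmf m (pref_vertex s G)))"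
    by (rule nn_integral_cmult) simp
  also have "\<dots> \<le> ennreal (exp (\<phi> * d / z)) *
       ennreal (exp (real m * (\<Sum>j\<in>{1..s}. real (deg s G j) * (g j + (g j)\<^sup>2)) / real (total_deg s G)))"
    by (intro mult_left_mono preferential_draws_mgf Dpos g1) simp
  also have "(\<Sum>j\<in>{1..s}. real (deg s G j) * (g j + (g j)\<^sup>2)) = (\<Sum>j\<in>{i}. real (deg s G j) * (g j + (g j)\<^sup>2))"
    using i by (intro sum.mono_neutral_right) (auto simp: g_def)
  also have "real m * \<dots> / real (total_deg s G) = d * (\<phi> / z + (\<phi> / z)\<^sup>2) / x"
    unfolding D using assms(1) by (simp add: g_def d_def x_def)
  also have "ennreal (exp (\<phi> * d / z)) * ennreal (exp (d * (\<phi> / z + (\<phi> / z)\<^sup>2) / x))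
       = ennreal (exp (\<phi> * d / z + d * (\<phi> / z + (\<phi> / z)\<^sup>2) / x))"
    by (simp add: exp_add ennreal_mult)
  also have "\<dots> \<le> ennreal (exp ((\<phi> + \<phi>\<^sup>2 / x) * (d / y)))"
  proof (intro ennreal_leI iffD2[OF exp_le_cancel_iff])
    have "\<phi> * d / z + d * (\<phi> / z) / x = \<phi> * d * (1 + 1 / x) / z"
      by (simp add: algebra_simps add_divide_distrib)
    also have "\<dots> = \<phi> * d / y"
    proof -
      have "1 + 1 / x > 0" using x by (simp add: add_pos_pos)
      then show ?thesis by (simp add: z)
    qed
    finally have lin: "\<phi> * d / z + d * (\<phi> / z) / x = \<phi> * d / y" .
    have "y \<le> z\<^sup>2" using y zy by (simp add: power2_eq_square) (smt (verit) mult_left_le mult_le_cancel_left1)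
    then have "\<phi>\<^sup>2 * d / x / z\<^sup>2 \<le> \<phi>\<^sup>2 * d / x / y"
      using x y zy by (intro divide_left_mono) (auto simp: d_def)
    then have "d * (\<phi> / z)\<^sup>2 / x \<le> \<phi>\<^sup>2 / x * (d / y)"
      by (simp add: power_divide mult.commute divide_divide_eq_left)
    then show "\<phi> * d / z + d * (\<phi> / z + (\<phi> / z)\<^sup>2) / x \<le> (\<phi> + \<phi>\<^sup>2 / x) * (d / y)"
      using lin by (simp add: distrib_left distrib_right add_divide_distrib)
  qed
  finally show ?thesis by (simp add: x_def y_def z_def d_def)
qed

text \<open>
  Running the step backwards from the final coefficient \<open>\<sigma>\<close>, each of the at most \<open>n\<close> steps has to add
  \<open>\<phi>\<^sup>2 / x\<^sub>s\<close> to the coefficient \<open>\<phi>\<close>.  As long as \<open>\<bar>\<phi>\<bar> \<le> 2 \<bar>\<sigma>\<bar>\<close>, adding \<open>4 \<sigma>\<^sup>2 / m\<close> is enough, and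
  the assumption on \<open>\<sigma>\<close> ensures that the total addition is at most \<open>\<bar>\<sigma>\<bar>\<close>.
\<close>
lemma normalized_degree_mgf:
  assumes m: "m \<ge> 1" and n: "m + 1 + k \<le> n" and i: "1 \<le> i" "i \<le> m + 1 + k"
    and \<sigma>: "4 * \<bar>\<sigma>\<bar> * real n \<le> real m"
  shows "(\<integral>\<^sup>+G. ennreal (exp (\<sigma> * (real (deg (m + 1 + k) G i) / growth m (m + 1 + k) - real m * weight m i)))
            \<partial>measure_pmf (BA_at m k)) \<le> ennreal (exp (4 * \<sigma>\<^sup>2 * real n))"
proof -
  define k0 where "k0 = max i (m + 1) - (m + 1)"
  have k0: "max i (m + 1) = m + 1 + k0" "k0 \<le> k" using i by (auto simp: k0_def)
  define \<phi> where "\<phi> = (\<lambda>j. \<sigma> + 4 * \<sigma>\<^sup>2 * (real k - real j) / real m)"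
  let ?N = "\<lambda>j G. real (deg (m + 1 + j) G i) / growth m (m + 1 + j)"
  have mpos: "real m > 0" using m by simp
  have tweak: "4 * \<sigma>\<^sup>2 * (real k - real j) / real m \<le> \<bar>\<sigma>\<bar>" "0 \<le> 4 * \<sigma>\<^sup>2 * (real k - real j) / real m"
    if "j \<le> k" for j
  proof -
    have "4 * \<bar>\<sigma>\<bar> * (real k - real j) \<le> 4 * \<bar>\<sigma>\<bar> * real n"
      using n by (intro mult_left_mono) auto
    then have "\<bar>\<sigma>\<bar> * (4 * \<bar>\<sigma>\<bar> * (real k - real j)) \<le> \<bar>\<sigma>\<bar> * real m"
      using \<sigma> by (intro mult_left_mono) auto
    then show "4 * \<sigma>\<^sup>2 * (real k - real j) / real m \<le> \<bar>\<sigma>\<bar>"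
      using mpos by (simp add: divide_le_eq power2_eq_square algebra_simps abs_mult_self_eq)
    show "0 \<le> 4 * \<sigma>\<^sup>2 * (real k - real j) / real m" using that by simp
  qed
  have \<phi>2: "\<bar>\<phi> j\<bar> \<le> 2 * \<bar>\<sigma>\<bar>" if "j \<le> k" for j
    using tweak[OF that] unfolding \<phi>_def by linarith
  have "4 * \<bar>\<sigma>\<bar> * real n \<ge> 4 * \<bar>\<sigma>\<bar> * real m" using n by (intro mult_left_mono) auto
  then have "(4 * \<bar>\<sigma>\<bar>) * real m \<le> 1 * real m" using \<sigma> by simp
  then have "4 * \<bar>\<sigma>\<bar> \<le> 1" using mpos by (rule mult_right_le_imp_le)
  then have \<phi>1: "\<bar>\<phi> j\<bar> \<le> 1" if "j \<le> k" for j
    using \<phi>2[OF that] by linarith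
  have main: "(\<integral>\<^sup>+G. ennreal (exp (\<phi> j * ?N j G)) \<partial>measure_pmf (BA_at m j))
                 \<le> ennreal (exp (\<phi> k0 * (real m * weight m i)))"
    if "k0 \<le> j" "j \<le> k" for j
    using that
  proof (induction j rule: dec_induct)
    case base
    have w: "growth m (m + 1 + k0) = growth m i"
      using k0(1) by (cases "i \<le> m + 1") (auto simp: growth_initial)
    have "(\<integral>\<^sup>+G. ennreal (exp (\<phi> k0 * ?N k0 G)) \<partial>measure_pmf (BA_at m k0))
        = (\<integral>\<^sup>+G. ennreal (exp (\<phi> k0 * (real m * weight m i))) \<partial>measure_pmf (BA_at m k0))"
      using deg_at_birth[OF m _ i(1) k0(1)] w
      by (intro nn_integral_cong_AE) (auto simp: AE_measure_pmf_iff weight_def)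
    then show ?case by simp
  next
    case (step j)
    let ?s = "m + 1 + j"
    have "(\<integral>\<^sup>+H. ennreal (exp (\<phi> (Suc j) * ?N (Suc j) H)) \<partial>measure_pmf (BA_step m (m + 1 + Suc j) G))
           \<le> ennreal (exp (\<phi> j * ?N j G))" if G: "G \<in> set_pmf (BA_at m j)" for G
    proof -
      have "(\<integral>\<^sup>+H. ennreal (exp (\<phi> (Suc j) * ?N (Suc j) H)) \<partial>measure_pmf (BA_step m (m + 1 + Suc j) G))
           \<le> ennreal (exp ((\<phi> (Suc j) + (\<phi> (Suc j))\<^sup>2 / norm_total_deg m ?s) * ?N j G))"
        using normalized_degree_step[OF m _ total_deg_eq[OF m G], of i "\<phi> (Suc j)"] i(1) k0(1) step \<phi>1
        by auto
      also have "\<dots> \<le> ennreal (exp (\<phi> j * ?N j G))"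
      proof (intro ennreal_leI iffD2[OF exp_le_cancel_iff] mult_right_mono)
        have "(\<phi> (Suc j))\<^sup>2 \<le> (2 * \<bar>\<sigma>\<bar>)\<^sup>2"
          using \<phi>2[of "Suc j"] step by (intro iffD1[OF abs_le_square_iff]) auto
        also have "\<dots> = 4 * \<sigma>\<^sup>2" by (simp add: power_mult_distrib)
        finally have "(\<phi> (Suc j))\<^sup>2 / norm_total_deg m ?s \<le> 4 * \<sigma>\<^sup>2 / real m"
          using norm_total_deg_ge[of m ?s] mpos by (intro frac_le) auto
        also have "\<dots> = \<phi> j - \<phi> (Suc j)"
          by (simp add: \<phi>_def algebra_simps flip: diff_divide_distrib add_divide_distrib)
        finally show "\<phi> (Suc j) + (\<phi> (Suc j))\<^sup>2 / norm_total_deg m ?s \<le> \<phi> j" by simp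
        show "0 \<le> ?N j G" using growth_pos[of m ?s] by (simp add: less_imp_le)
      qed
      finally show ?thesis .
    qed
    then have "(\<integral>\<^sup>+G. ennreal (exp (\<phi> (Suc j) * ?N (Suc j) G)) \<partial>measure_pmf (BA_at m (Suc j)))
        \<le> (\<integral>\<^sup>+G. ennreal (exp (\<phi> j * ?N j G)) \<partial>measure_pmf (BA_at m j))"
      unfolding BA_at.simps nn_integral_bind_pmf
      by (intro nn_integral_mono_AE) (auto simp: AE_measure_pmf_iff)
    then show ?case using step by (auto intro: order.trans)
  qed
  have "(\<integral>\<^sup>+G. ennreal (exp (\<sigma> * (?N k G - real m * weight m i))) \<partial>measure_pmf (BA_at m k))
      = (\<integral>\<^sup>+G. ennreal (exp (- (\<sigma> * real m * weight m i))) * ennreal (exp (\<phi> k * ?N k G)) \<partial>measure_pmf (BA_at m k))"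
    by (simp add: \<phi>_def algebra_simps flip: ennreal_mult exp_add)
  also have "\<dots> = ennreal (exp (- (\<sigma> * real m * weight m i))) * (\<integral>\<^sup>+G. ennreal (exp (\<phi> k * ?N k G)) \<partial>measure_pmf (BA_at m k))"
    by (rule nn_integral_cmult) simp
  also have "\<dots> \<le> ennreal (exp (- (\<sigma> * real m * weight m i))) * ennreal (exp (\<phi> k0 * (real m * weight m i)))"
    using main[of k] k0(2) by (intro mult_left_mono) auto
  also have "\<dots> = ennreal (exp ((\<phi> k0 - \<sigma>) * (real m * weight m i)))"
    by (simp add: algebra_simps flip: ennreal_mult exp_add)
  also have "\<dots> \<le> ennreal (exp (4 * \<sigma>\<^sup>2 * real n))"
  proof (intro ennreal_leI iffD2[OF exp_le_cancel_iff])
    have "(\<phi> k0 - \<sigma>) * (real m * weight m i) = 4 * \<sigma>\<^sup>2 * (real k - real k0) * weight m i"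
      using mpos by (simp add: \<phi>_def)
    also have "\<dots> \<le> 4 * \<sigma>\<^sup>2 * (real k - real k0) * 1"
      using k0(2) weight_le_1 by (intro mult_left_mono) auto
    also have "\<dots> \<le> 4 * \<sigma>\<^sup>2 * real n"
      using n by (simp add: mult_left_mono)
    finally show "(\<phi> k0 - \<sigma>) * (real m * weight m i) \<le> 4 * \<sigma>\<^sup>2 * real n" .
  qed
  finally show ?thesis .
qed

text \<open>
  Given the past, the weighted row of a new vertex is a sum of \<open>m\<close> independent terms in \<open>[0, 1]\<close> whose mean
  is the subtracted ratio, so only the second-order term of \<open>preferential_draws_mgf\<close> survives.
\<close>
lemma new_row_mgf:
  assumes m: "m \<ge> 1" and \<sigma>: "\<bar>\<sigma>\<bar> \<le> 1" and s: "s = m + 1 + k"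
  shows "(\<integral>\<^sup>+G. ennreal (exp (\<sigma> * ((\<Sum>j\<in>{1..s}. weight m j * real (G (Suc s) j))
              - (\<Sum>j\<in>{1..s}. weight m j * real (deg s G j)) / norm_total_deg m s)))
            \<partial>measure_pmf (BA_at m (Suc k))) \<le> ennreal (exp (\<sigma>\<^sup>2 * real m))"
proof -
  have "(\<integral>\<^sup>+G. ennreal (exp (\<sigma> * ((\<Sum>j\<in>{1..s}. weight m j * real (G (Suc s) j))
              - (\<Sum>j\<in>{1..s}. weight m j * real (deg s G j)) / norm_total_deg m s)))
            \<partial>measure_pmf (BA_step m (m + 1 + Suc k) H)) \<le> ennreal (exp (\<sigma>\<^sup>2 * real m))"
    if H: "H \<in> set_pmf (BA_at m k)" for H
  proof -
    define x where "x = norm_total_deg m s"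
    define W where "W = (\<Sum>j\<in>{1..s}. weight m j * real (deg s H j)) / x"
    have x: "x > 0" using norm_total_deg_ge[of m s] by (simp add: x_def s)
    have D: "real (total_deg s H) = real m * x"
      using total_deg_eq[OF m H] by (simp add: x_def s)
    have "real (total_deg s H) > 0" unfolding D using x m by simp
    then have Dpos: "total_deg s H > 0" by simp
    define g where "g = (\<lambda>j. \<sigma> * weight m j)"
    have g1: "\<bar>g j\<bar> \<le> 1" for j
      using mult_mono[OF \<sigma> weight_le_1[of m j]] weight_pos[of m j] by (simp add: g_def abs_mult)
    have row: "(\<Sum>j\<in>{1..s}. weight m j * real (add_vertex (Suc s) xs H (Suc s) j)) * \<sigma> = (\<Sum>u\<leftarrow>xs. g u)"
      if "set xs \<subseteq> {1..s}" for xs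
      using that
    proof (induction xs)
      case (Cons u xs)
      have "(\<Sum>j\<in>{1..s}. weight m j * real (count_list (u # xs) j))
          = (\<Sum>j\<in>{1..s}. weight m j * real (count_list xs j) + (if j = u then weight m j else 0))"
        by (intro sum.cong refl) (auto simp: algebra_simps)
      also have "\<dots> = (\<Sum>j\<in>{1..s}. weight m j * real (count_list xs j)) + weight m u"
        using Cons.prems by (simp add: sum.distrib)
      finally show ?case using Cons by (simp add: add_vertex_def g_def algebra_simps)
    qed (simp add: add_vertex_def)
    have old: "deg s (add_vertex (Suc s) xs H) j = deg s H j" if "j \<in> {1..s}" for xs j
      using that by (intro deg_add_vertex_restrict) auto
    have supp: "set xs \<subseteq> {1..s}" if "xs \<in> set_pmf (replicate_pmf m (pref_vertex s H))" for xs
      using that set_pref_vertex[OF Dpos] by (auto simp: set_replicate_pmf lists_eq_set)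
    have "(\<integral>\<^sup>+G. ennreal (exp (\<sigma> * ((\<Sum>j\<in>{1..s}. weight m j * real (G (Suc s) j))
              - (\<Sum>j\<in>{1..s}. weight m j * real (deg s G j)) / x)))
            \<partial>measure_pmf (BA_step m (Suc s) H))
        = (\<integral>\<^sup>+xs. ennreal (exp (- (\<sigma> * W))) * ennreal (exp (\<Sum>u\<leftarrow>xs. g u)) \<partial>measure_pmf (replicate_pmf m (pref_vertex s H)))"
      unfolding BA_step_def nn_integral_map_pmf diff_Suc_1
    proof (intro nn_integral_cong_AE, unfold AE_measure_pmf_iff, intro ballI)
      fix xs assume "xs \<in> set_pmf (replicate_pmf m (pref_vertex s H))"
      then have r: "(\<Sum>j\<in>{1..s}. weight m j * real (add_vertex (Suc s) xs H (Suc s) j)) * \<sigma> = (\<Sum>u\<leftarrow>xs. g u)"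
        by (intro row supp)
      have "(\<Sum>j\<in>{1..s}. weight m j * real (deg s (add_vertex (Suc s) xs H) j)) / x = W"
        unfolding W_def by (intro arg_cong2[of _ _ _ _ "(/)"] sum.cong refl) (simp only: old)
      then show "ennreal (exp (\<sigma> * ((\<Sum>j\<in>{1..s}. weight m j * real (add_vertex (Suc s) xs H (Suc s) j))
              - (\<Sum>j\<in>{1..s}. weight m j * real (deg s (add_vertex (Suc s) xs H) j)) / x)))
            = ennreal (exp (- (\<sigma> * W))) * ennreal (exp (\<Sum>u\<leftarrow>xs. g u))"
        by (simp add: right_diff_distrib mult.commute[of \<sigma>] flip: r ennreal_mult exp_add)
    qed
    also have "\<dots> = ennreal (exp (- (\<sigma> * W))) * (\<integral>\<^sup>+xs. ennreal (exp (\<Sum>u\<leftarrow>xs. g u)) \<partial>measure_pmf (replicate_pmf m (pref_vertex s H)))"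
      by (rule nn_integral_cmult) simp
    also have "\<dots> \<le> ennreal (exp (- (\<sigma> * W))) *
         ennreal (exp (real m * (\<Sum>j\<in>{1..s}. real (deg s H j) * (g j + (g j)\<^sup>2)) / real (total_deg s H)))"
      by (intro mult_left_mono preferential_draws_mgf Dpos g1) simp
    also have "\<dots> = ennreal (exp (real m * (\<Sum>j\<in>{1..s}. real (deg s H j) * (g j + (g j)\<^sup>2)) / real (total_deg s H) - \<sigma> * W))"
      by (simp flip: ennreal_mult exp_add)
    also have "\<dots> \<le> ennreal (exp (\<sigma>\<^sup>2 * real m))"
    proof (intro ennreal_leI iffD2[OF exp_le_cancel_iff])
      have "(\<Sum>j\<in>{1..s}. real (deg s H j) * (g j + (g j)\<^sup>2))
          \<le> (\<Sum>j\<in>{1..s}. \<sigma> * (weight m j * real (deg s H j)) + \<sigma>\<^sup>2 * real (deg s H j))"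
      proof (rule sum_mono)
        fix j
        have "(weight m j)\<^sup>2 \<le> 1"
          using weight_pos[of m j] weight_le_1[of m j] by (simp add: abs_square_le_1)
        then have "real (deg s H j) * (\<sigma>\<^sup>2 * (weight m j)\<^sup>2) \<le> real (deg s H j) * (\<sigma>\<^sup>2 * 1)"
          by (intro mult_left_mono) auto
        then show "real (deg s H j) * (g j + (g j)\<^sup>2) \<le> \<sigma> * (weight m j * real (deg s H j)) + \<sigma>\<^sup>2 * real (deg s H j)"
          by (simp add: g_def power_mult_distrib algebra_simps)
      qed
      also have "\<dots> = \<sigma> * (W * x) + \<sigma>\<^sup>2 * real (total_deg s H)"
        using x by (simp add: W_def sum.distrib total_deg_def flip: sum_distrib_left)
      also have "\<dots> = x * (\<sigma> * W + \<sigma>\<^sup>2 * real m)"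
        by (simp add: D algebra_simps)
      finally have "(\<Sum>j\<in>{1..s}. real (deg s H j) * (g j + (g j)\<^sup>2)) / x \<le> \<sigma> * W + \<sigma>\<^sup>2 * real m"
        using x by (simp add: divide_le_eq mult.commute)
      then show "real m * (\<Sum>j\<in>{1..s}. real (deg s H j) * (g j + (g j)\<^sup>2)) / real (total_deg s H) - \<sigma> * W \<le> \<sigma>\<^sup>2 * real m"
        unfolding D using m by simp
    qed
    finally show ?thesis by (simp add: x_def s)
  qed
  then have "(\<integral>\<^sup>+G. ennreal (exp (\<sigma> * ((\<Sum>j\<in>{1..s}. weight m j * real (G (Suc s) j))
              - (\<Sum>j\<in>{1..s}. weight m j * real (deg s G j)) / norm_total_deg m s)))
            \<partial>measure_pmf (BA_at m (Suc k)))
         \<le> (\<integral>\<^sup>+H. ennreal (exp (\<sigma>\<^sup>2 * real m)) \<partial>measure_pmf (BA_at m k))"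
    unfolding BA_at.simps nn_integral_bind_pmf
    by (intro nn_integral_mono_AE) (auto simp: AE_measure_pmf_iff)
  then show ?thesis by simp
qed
definition degree_deviation :: "nat \<Rightarrow> nat \<Rightarrow> nat \<Rightarrow> multigraph \<Rightarrow> real" where
  "degree_deviation m s j G = real (deg s G j) / growth m s - real m * weight m j"

definition new_row_deviation :: "nat \<Rightarrow> nat \<Rightarrow> multigraph \<Rightarrow> real" where
  "new_row_deviation m s G =
     (\<Sum>j\<in>{1..s}. weight m j * real (G (Suc s) j))
       - (\<Sum>j\<in>{1..s}. weight m j * real (deg s G j)) / norm_total_deg m s"

lemma degree_deviation_tail:
  assumes m: "m \<ge> 1" and s: "m + 1 \<le> s" "s \<le> n" and j: "1 \<le> j" "j \<le> s"
    and \<eta>: "\<eta> \<ge> 0" "4 * \<eta> * real n \<le> real m"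
  shows "measure (measure_pmf (dense_BA n m)) {G. \<bar>degree_deviation m s j G\<bar> > a}
           \<le> 2 * exp (4 * \<eta>\<^sup>2 * real n - \<eta> * a)"
proof (rule pmf_two_sided_Chernoff[OF _ \<eta>(1)])
  fix \<sigma> assume \<sigma>: "\<bar>\<sigma>\<bar> = \<eta>"
  define k where "k = s - (m + 1)"
  have k: "s = m + 1 + k" "n - (m + 1) = k + (n - s)" using s by (auto simp: k_def)
  have "(\<integral>\<^sup>+G. ennreal (exp (\<sigma> * degree_deviation m s j G)) \<partial>measure_pmf (dense_BA n m))
      = (\<integral>\<^sup>+G. ennreal (exp (\<sigma> * degree_deviation m s j G)) \<partial>measure_pmf (BA_at m k))"
    unfolding dense_BA_def k(2)
  proof (rule nn_integral_BA_at_later)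
    fix t xs H assume "m + 1 + k < t"
    then have "deg s (add_vertex t xs H) j = deg s H j"
      using j k by (intro deg_add_vertex_restrict) auto
    then show "ennreal (exp (\<sigma> * degree_deviation m s j (add_vertex t xs H)))
             = ennreal (exp (\<sigma> * degree_deviation m s j H))"
      by (simp add: degree_deviation_def)
  qed
  also have "\<dots> \<le> ennreal (exp (4 * \<sigma>\<^sup>2 * real n))"
    unfolding degree_deviation_def k(1)
    by (rule normalized_degree_mgf) (use m s j \<eta> \<sigma> k in auto)
  also have "\<sigma>\<^sup>2 = \<eta>\<^sup>2" using \<sigma> by (metis power2_abs)
  finally show "(\<integral>\<^sup>+G. ennreal (exp (\<sigma> * degree_deviation m s j G)) \<partial>measure_pmf (dense_BA n m))
                  \<le> ennreal (exp (4 * \<eta>\<^sup>2 * real n))" .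
qed

lemma new_row_deviation_tail:
  assumes m: "m \<ge> 1" and s: "m + 1 \<le> s" "s < n"
    and \<eta>: "\<eta> \<ge> 0" "4 * \<eta> * real n \<le> real m"
  shows "measure (measure_pmf (dense_BA n m)) {G. \<bar>new_row_deviation m s G\<bar> > a}
           \<le> 2 * exp (4 * \<eta>\<^sup>2 * real n - \<eta> * a)"
proof (rule pmf_two_sided_Chernoff[OF _ \<eta>(1)])
  fix \<sigma> assume \<sigma>: "\<bar>\<sigma>\<bar> = \<eta>"
  define k where "k = s - (m + 1)"
  have k: "s = m + 1 + k" "n - (m + 1) = Suc k + (n - Suc s)" using s by (auto simp: k_def)
  have "(\<integral>\<^sup>+G. ennreal (exp (\<sigma> * new_row_deviation m s G)) \<partial>measure_pmf (dense_BA n m))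
      = (\<integral>\<^sup>+G. ennreal (exp (\<sigma> * new_row_deviation m s G)) \<partial>measure_pmf (BA_at m (Suc k)))"
    unfolding dense_BA_def k(2)
  proof (rule nn_integral_BA_at_later)
    fix t xs H assume t: "m + 1 + Suc k < t"
    have "deg s (add_vertex t xs H) j = deg s H j" if "j \<in> {1..s}" for j
      using that t k by (intro deg_add_vertex_restrict) auto
    moreover have "add_vertex t xs H (Suc s) j = H (Suc s) j" if "j \<in> {1..s}" for j
      using that t k by (simp add: add_vertex_def)
    ultimately have "new_row_deviation m s (add_vertex t xs H) = new_row_deviation m s H"
      unfolding new_row_deviation_def
      by (intro arg_cong2[of _ _ _ _ "(-)"] arg_cong2[of _ _ _ _ "(/)"] sum.cong refl) simp_all
    then show "ennreal (exp (\<sigma> * new_row_deviation m s (add_vertex t xs H)))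
             = ennreal (exp (\<sigma> * new_row_deviation m s H))" by simp
  qed
  also have "\<dots> \<le> ennreal (exp (\<sigma>\<^sup>2 * real m))"
    unfolding new_row_deviation_def
  proof (rule new_row_mgf[OF m _ k(1)])
    have "\<eta> * real m \<le> \<eta> * real n" using s \<eta> by (intro mult_left_mono) auto
    moreover have "0 \<le> \<eta> * real n" using \<eta> by simp
    ultimately have "\<eta> * real m \<le> 1 * real m" using \<eta>(2) by linarith
    then have "\<eta> \<le> 1" by (rule mult_right_le_imp_le) (use m in simp)
    then show "\<bar>\<sigma>\<bar> \<le> 1" using \<sigma> by simp
  qed
  also have "\<dots> \<le> ennreal (exp (4 * \<eta>\<^sup>2 * real n))"
  proof (intro ennreal_leI iffD2[OF exp_le_cancel_iff] mult_mono)
    have "\<sigma>\<^sup>2 = \<eta>\<^sup>2" using \<sigma> by (metis power2_abs)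
    then show "\<sigma>\<^sup>2 \<le> 4 * \<eta>\<^sup>2" by simp
  qed (use s in auto)
  finally show "(\<integral>\<^sup>+G. ennreal (exp (\<sigma> * new_row_deviation m s G)) \<partial>measure_pmf (dense_BA n m))
                  \<le> ennreal (exp (4 * \<eta>\<^sup>2 * real n))" .
qed

definition typical_graphs :: "nat \<Rightarrow> nat \<Rightarrow> real \<Rightarrow> multigraph set" where
  "typical_graphs n m a =
     {G. (\<forall>s\<in>{m+1..n}. \<forall>j\<in>{1..s}. \<bar>degree_deviation m s j G\<bar> \<le> a)
       \<and> (\<forall>s\<in>{m+1..<n}. \<bar>new_row_deviation m s G\<bar> \<le> a)}"

lemma prob_not_typical:
  assumes m: "m \<ge> 1" and \<eta>: "\<eta> \<ge> 0" "4 * \<eta> * real n \<le> real m"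
  shows "measure (measure_pmf (dense_BA n m)) (- typical_graphs n m a)
           \<le> 4 * (real n)\<^sup>2 * exp (4 * \<eta>\<^sup>2 * real n - \<eta> * a)"
proof -
  let ?P = "measure (measure_pmf (dense_BA n m))"
  define q where "q = 2 * exp (4 * \<eta>\<^sup>2 * real n - \<eta> * a)"
  let ?I = "Sigma {m+1..n} (\<lambda>s. {1..s})"
  let ?D = "\<lambda>p. {G. \<bar>degree_deviation m (fst p) (snd p) G\<bar> > a}"
  let ?R = "\<lambda>s. {G. \<bar>new_row_deviation m s G\<bar> > a}"
  have q: "q \<ge> 0" by (simp add: q_def)
  have sub: "?I \<subseteq> {1..n} \<times> {1..n}" by auto
  have fin: "finite ?I" by (rule finite_subset[OF sub]) auto
  have "card ?I \<le> card ({1..n} \<times> {1..n})" by (rule card_mono[OF _ sub]) auto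
  also have "\<dots> = n * n" by simp
  finally have "real (card ?I) \<le> real (n * n)" by (simp only: of_nat_le_iff)
  then have card: "real (card ?I) \<le> (real n)\<^sup>2"
    by (simp only: power2_eq_square of_nat_mult)
  have cover: "- typical_graphs n m a \<subseteq> (\<Union>p\<in>?I. ?D p) \<union> (\<Union>s\<in>{m+1..<n}. ?R s)"
  proof
    fix G assume "G \<in> - typical_graphs n m a"
    then consider s j where "s \<in> {m+1..n}" "j \<in> {1..s}" "\<bar>degree_deviation m s j G\<bar> > a"
      | s where "s \<in> {m+1..<n}" "\<bar>new_row_deviation m s G\<bar> > a"
      unfolding typical_graphs_def by (auto simp: not_le)
    then show "G \<in> (\<Union>p\<in>?I. ?D p) \<union> (\<Union>s\<in>{m+1..<n}. ?R s)"
    proof cases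
      case (1 s j)
      then have "(s, j) \<in> ?I" "G \<in> ?D (s, j)" by auto
      then show ?thesis by blast
    next
      case (2 s)
      then show ?thesis by blast
    qed
  qed
  have "?P (- typical_graphs n m a) \<le> ?P ((\<Union>p\<in>?I. ?D p) \<union> (\<Union>s\<in>{m+1..<n}. ?R s))"
    by (rule measure_pmf.finite_measure_mono[OF cover]) simp
  also have "\<dots> \<le> ?P (\<Union>p\<in>?I. ?D p) + ?P (\<Union>s\<in>{m+1..<n}. ?R s)"
    by (rule measure_Un_le) auto
  also have "?P (\<Union>p\<in>?I. ?D p) \<le> (\<Sum>p\<in>?I. ?P (?D p))"
    by (rule measure_UNION_le[OF fin]) auto
  also have "\<dots> \<le> (\<Sum>p\<in>?I. q)"
    unfolding q_def using degree_deviation_tail[OF m _ _ _ _ \<eta>] by (intro sum_mono) auto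
  also have "\<dots> \<le> (real n)\<^sup>2 * q"
    unfolding sum_constant using card q by (intro mult_right_mono)
  also have "?P (\<Union>s\<in>{m+1..<n}. ?R s) \<le> (\<Sum>s\<in>{m+1..<n}. ?P (?R s))"
    by (rule measure_UNION_le) auto
  also have "\<dots> \<le> (\<Sum>s\<in>{m+1..<n}. q)"
    unfolding q_def using new_row_deviation_tail[OF m _ _ \<eta>] by (intro sum_mono) auto
  also have "\<dots> \<le> (real n)\<^sup>2 * q"
  proof -
    have "real (n - (m + 1)) \<le> real (n * n)"
      unfolding of_nat_le_iff by (cases n) auto
    then show ?thesis using q by (simp add: mult_right_mono power2_eq_square)
  qed
  finally show ?thesis by (simp add: q_def)
qed

section \<open>Row sums of a typical graph\<close>

lemma deg_Suc: "deg (Suc s) G i = deg s G i + G i (Suc s)"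
  by (simp add: deg_def)

text \<open>
  Summation by parts: \<open>G i t = deg\<^sub>i(t) - deg\<^sub>i(t - 1)\<close>, and \<open>growth\<close> satisfies
  \<open>g\<^sub>t / g\<^sub>t\<^sub>+\<^sub>1 = x\<^sub>t / (x\<^sub>t + 1) = 1 - 1 / (x\<^sub>t + 1)\<close>.  No estimate enters.
\<close>
lemma forward_row_telescope:
  assumes "m + 1 \<le> a" "a \<le> n"
  shows "(\<Sum>t\<in>{Suc a..n}. real (G i t) * weight m t)
           = real (deg n G i) / growth m n - real (deg a G i) / growth m a
             + (\<Sum>t\<in>{a..<n}. real (deg t G i) / growth m t / (norm_total_deg m t + 1))"
  using assms(2)
proof (induction n rule: dec_induct)
  case base
  then show ?case by simp
next
  case (step n)
  define x where "x = norm_total_deg m n"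
  define y where "y = growth m n"
  have x: "x > 0" using norm_total_deg_ge[of m n] step.hyps assms(1) by (simp add: x_def)
  have y: "y > 0" by (simp add: y_def growth_pos)
  have z: "growth m (Suc n) = y * (x + 1) / x"
    using growth_Suc[of m n] step.hyps assms(1) x by (simp add: x_def y_def field_simps)
  have "real (G i (Suc n)) * weight m (Suc n)
      = real (deg (Suc n) G i) / growth m (Suc n) - real (deg n G i) / growth m (Suc n)"
    by (simp add: weight_def deg_Suc add_divide_distrib)
  also have "real (deg n G i) / growth m (Suc n)
      = real (deg n G i) / y - real (deg n G i) / y / (x + 1)"
  proof -
    have "real (deg n G i) / growth m (Suc n) = real (deg n G i) / y * (x / (x + 1))"
      by (simp add: z)
    also have "x / (x + 1) = 1 - 1 / (x + 1)" using x by (simp add: field_simps)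
    finally show ?thesis by (simp add: right_diff_distrib)
  qed
  finally show ?case
    using step by (simp add: x_def y_def)
qed

text \<open>
  Split the row at \<open>a = max i (m + 1)\<close>.  The entries after \<open>a\<close> are handled by \<open>forward_row_telescope\<close>; the
  normalised degrees in it are all close to \<open>m w\<^sub>i\<close>.  For \<open>i \<le> m + 1\<close> the entries up to \<open>a\<close> have
  weight one and add up to the degree in the initial graph.  For \<open>i > m + 1\<close> they form the row that \<open>i\<close> drew
  on arrival; its mean is \<open>m g\<^sub>s / x\<^sub>s\<close> times a sum of squared weights, for \<open>s = i - 1\<close>, and
  \<open>m g\<^sub>s / x\<^sub>s\<close> agrees with \<open>w\<^sub>i\<close> up to a factor between \<open>m / (m + 1)\<close> and \<open>1\<close>.
  The bound \<open>K\<close> on \<open>n / m\<close> controls the number of accumulated errors.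
\<close>
lemma row_sum_approx:
  fixes \<delta> K :: real
  assumes m: "m \<ge> 1" and n: "m + 1 \<le> n" and K: "K \<ge> 1" "real n \<le> K * real m"
    and dev: "\<And>s j. m + 1 \<le> s \<Longrightarrow> s \<le> n \<Longrightarrow> 1 \<le> j \<Longrightarrow> j \<le> s \<Longrightarrow>
      \<bar>real (deg s G j) / growth m s - real m * weight m j\<bar> \<le> \<delta> * real n"
    and newrow: "\<And>s. m + 1 \<le> s \<Longrightarrow> s < n \<Longrightarrow>
      \<bar>(\<Sum>j\<in>{1..s}. weight m j * real (G (Suc s) j))
         - (\<Sum>j\<in>{1..s}. weight m j * real (deg s G j)) / norm_total_deg m s\<bar> \<le> \<delta> * real n"
    and loopless: "G i i = 0" and \<delta>: "\<delta> \<ge> 0" and i: "1 \<le> i" "i \<le> n"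
  shows "\<bar>(\<Sum>j\<in>{1..n}. real (G i j) * weight m j)
           - (real m + real m / 2 * ln ((2 * real n - real m) / real m)) * weight m i\<bar>
         \<le> 6 * K\<^sup>2 * (\<delta> * real n) + 4 * K"
proof -
  define e where "e = \<delta> * real n"
  define a where "a = max i (m + 1)"
  define S where "S = (\<Sum>j\<in>{1..a - 1}. (weight m j)\<^sup>2)"
  define H where "H = (\<Sum>t\<in>{a..<n}. 1 / (norm_total_deg m t + 1))"
  define w where "w = weight m i"
  define L where "L = real m + real m / 2 * ln ((2 * real n - real m) / real m)"
  have e: "e \<ge> 0" using \<delta> by (simp add: e_def)
  have mpos: "real m \<ge> 1" using m by simp
  have a: "m + 1 \<le> a" "i \<le> a" "a \<le> n" using i n by (auto simp: a_def)
  have w: "0 < w" "w \<le> 1" by (auto simp: w_def weight_pos weight_le_1)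
  have nm: "real n / real m \<le> K" using K m by (simp add: divide_le_eq)
  have K2: "K \<le> K\<^sup>2" using K by (simp add: power2_eq_square)
  have N: "\<bar>real (deg s G i) / growth m s - real m * w\<bar> \<le> e" if "a \<le> s" "s \<le> n" for s
    using dev[of s i] that a i by (simp add: e_def w_def)

  define F where "F = (\<Sum>t\<in>{Suc a..n}. real (G i t) * weight m t)"
  have F: "\<bar>F - real m * w * H\<bar> \<le> 2 * e + K * e"
  proof -
    have "\<bar>(\<Sum>t\<in>{a..<n}. real (deg t G i) / growth m t / (norm_total_deg m t + 1)) - real m * w * H\<bar>
        = \<bar>\<Sum>t\<in>{a..<n}. (real (deg t G i) / growth m t - real m * w) / (norm_total_deg m t + 1)\<bar>"
      by (simp add: H_def sum_distrib_left diff_divide_distrib sum_subtractf)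
    also have "\<dots> \<le> (\<Sum>t\<in>{a..<n}. e / real m)"
    proof (intro order.trans[OF sum_abs] sum_mono)
      fix t assume t: "t \<in> {a..<n}"
      then have "real m \<le> norm_total_deg m t + 1" using norm_total_deg_ge[of m t] a by simp
      then show "\<bar>(real (deg t G i) / growth m t - real m * w) / (norm_total_deg m t + 1)\<bar> \<le> e / real m"
        using N[of t] t mpos e by (simp add: abs_divide del: of_nat_add) (intro frac_le, auto)
    qed
    also have "\<dots> = real (n - a) / real m * e" by simp
    also have "\<dots> \<le> K * e"
    proof (intro mult_right_mono e)
      have "real (n - a) / real m \<le> real n / real m" by (intro divide_right_mono) auto
      then show "real (n - a) / real m \<le> K" using nm by linarith
    qed
    finally show ?thesis
      using N[of n] N[of a] a forward_row_telescope[OF a(1,3), of G i] unfolding F_def by linarith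
  qed

  define B where "B = (\<Sum>j\<in>{1..a}. real (G i j) * weight m j)"
  have split: "(\<Sum>j\<in>{1..n}. real (G i j) * weight m j) = B + F"
  proof -
    have "{1..n} = {1..a} \<union> {Suc a..n}" using a by auto
    then show ?thesis unfolding B_def F_def by (simp add: sum.union_disjoint)
  qed
  have B: "\<bar>B - w * S\<bar> \<le> e + 2 * K\<^sup>2 * e + K"
  proof (cases "i \<le> m + 1")
    case True
    then have a_eq: "a = m + 1" by (simp add: a_def)
    have "B = real (deg (m + 1) G i)"
      unfolding B_def a_eq deg_def of_nat_sum by (intro sum.cong refl) (auto simp: weight_def growth_initial)
    moreover have "S = (\<Sum>j\<in>{1..m}. 1)"
      unfolding S_def a_eq by (intro sum.cong) (auto simp: weight_def growth_initial)
    moreover have "w = 1" using True by (simp add: w_def weight_def growth_initial)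
    ultimately have "\<bar>B - w * S\<bar> \<le> e"
      using N[of "m + 1"] n by (simp add: a_eq growth_initial)
    moreover have "0 \<le> 2 * K\<^sup>2 * e" using e by simp
    ultimately show ?thesis using K by linarith
  next
    case False
    define s where "s = i - 1"
    have s: "i = Suc s" "a = Suc s" "m + 1 \<le> s" "s < n" using False i by (auto simp: s_def a_def)
    define x where "x = norm_total_deg m s"
    define g where "g = growth m s"
    define T where "T = (\<Sum>j\<in>{1..s}. weight m j * real (deg s G j))"
    have x: "x \<ge> real m + 1" using norm_total_deg_ge[OF s(3)] by (simp add: x_def)
    have g: "g > 0" by (simp add: g_def growth_pos)
    have S_eq: "S = (\<Sum>j\<in>{1..s}. (weight m j)\<^sup>2)" by (simp add: S_def s)
    have "B = (\<Sum>j\<in>{1..s}. weight m j * real (G (Suc s) j))"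
      using loopless by (simp add: B_def s mult.commute)
    then have 1: "\<bar>B - T / x\<bar> \<le> e"
      using newrow[OF s(3,4)] by (simp add: T_def x_def e_def)
    have "\<bar>T - g * (real m * S)\<bar>
        = \<bar>\<Sum>j\<in>{1..s}. g * weight m j * (real (deg s G j) / g - real m * weight m j)\<bar>"
      using g by (simp add: T_def S_eq right_diff_distrib sum_subtractf sum_distrib_left power2_eq_square mult_ac)
    also have "\<dots> \<le> (\<Sum>j\<in>{1..s}. g * e)"
    proof (intro order.trans[OF sum_abs] sum_mono)
      fix j assume "j \<in> {1..s}"
      then have "\<bar>real (deg s G j) / g - real m * weight m j\<bar> \<le> e"
        using dev[of s j] s by (simp add: g_def e_def)
      moreover have "g * weight m j \<le> g * 1" using g weight_le_1 by (intro mult_left_mono) auto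
      ultimately have "g * weight m j * \<bar>real (deg s G j) / g - real m * weight m j\<bar> \<le> g * 1 * e"
        using g weight_pos[of m j] by (intro mult_mono) auto
      then show "\<bar>g * weight m j * (real (deg s G j) / g - real m * weight m j)\<bar> \<le> g * e"
        using g weight_pos[of m j] by (simp add: abs_mult)
    qed
    also have "\<dots> = real s * g * e" by simp
    finally have "\<bar>T - g * (real m * S)\<bar> / x \<le> real s * g * e / x"
      using x by (intro divide_right_mono) auto
    also have "\<dots> \<le> real n * (2 * K) * e / real m"
    proof (intro frac_le mult_mono mult_right_mono e)
      have "g\<^sup>2 \<le> (x - 1) / real m" using growth_squared_upper[OF s(3) m] by (simp add: g_def x_def)
      also have "\<dots> \<le> (2 * real n) / real m" using s by (intro divide_right_mono) (auto simp: x_def norm_total_deg_def)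
      also have "\<dots> \<le> 2 * K" using nm by simp
      also have "\<dots> \<le> (2 * K)\<^sup>2" using K by (simp add: power2_eq_square)
      finally show "g \<le> 2 * K" by (rule power2_le_imp_le) (use K in simp)
    qed (use s x g K e mpos in auto)
    also have "\<dots> = real n / real m * (2 * K * e)" by simp
    also have "\<dots> \<le> K * (2 * K * e)" using nm K e by (intro mult_right_mono) auto
    finally have 2: "\<bar>T / x - g * (real m * S) / x\<bar> \<le> 2 * K\<^sup>2 * e"
      using x by (simp add: diff_divide_distrib[symmetric] abs_divide power2_eq_square mult_ac)
    \<comment> \<open>The factor by which \<open>m g\<^sub>s / x\<^sub>s\<close> misses \<open>w\<^sub>i\<close>; the two bounds on \<open>growth\<^sup>2\<close> pin it down to \<open>1 + O(1 / m)\<close>.\<close>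
    define r where "r = real m * g\<^sup>2 * (x + 1) / x\<^sup>2"
    have w_eq: "w = x / (g * (x + 1))"
    proof -
      have "1 + 1 / x = (x + 1) / x" using x by (simp add: field_simps)
      then show ?thesis using growth_Suc[OF s(3)] by (simp add: w_def weight_def s x_def g_def)
    qed
    have mg: "g * (real m * S) / x = r * (w * S)"
      using x g by (simp add: w_eq r_def power2_eq_square)
    have "real m * g\<^sup>2 \<le> x - 1"
      using growth_squared_upper[OF s(3) m] mpos by (simp add: g_def x_def field_simps)
    then have "real m * g\<^sup>2 * (x + 1) \<le> (x - 1) * (x + 1)" using x by (intro mult_right_mono) auto
    also have "\<dots> \<le> x\<^sup>2" by (simp add: power2_eq_square algebra_simps)
    finally have r1: "r \<le> 1" using x by (simp add: r_def divide_le_eq)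
    have "x / (real m + 1) \<le> g\<^sup>2" using growth_squared_lower[OF s(3)] by (simp add: g_def x_def)
    then have "real m * (x / (real m + 1)) * x \<le> real m * g\<^sup>2 * (x + 1)"
      using x by (intro mult_mono) auto
    then have "real m / (real m + 1) * x\<^sup>2 \<le> real m * g\<^sup>2 * (x + 1)"
      by (simp add: power2_eq_square)
    then have "real m / (real m + 1) \<le> r" using x by (simp add: r_def pos_le_divide_eq)
    moreover have "1 - real m / (real m + 1) = 1 / (real m + 1)" using mpos by (simp add: field_simps)
    ultimately have r2: "1 - r \<le> 1 / (real m + 1)" by linarith
    have S0: "0 \<le> S" by (simp add: S_def sum_nonneg)
    have "S \<le> (\<Sum>j\<in>{1..s}. 1)"
      unfolding S_eq using weight_pos weight_le_1
      by (intro sum_mono) (auto simp: abs_square_le_1 abs_of_pos)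
    then have Sn: "S \<le> real n" using s by simp
    have "w * S \<le> 1 * real n" using w Sn S0 by (intro mult_mono) auto
    then have "(1 - r) * (w * S) \<le> 1 / (real m + 1) * real n"
      using r1 r2 w S0 by (intro mult_mono) auto
    also have "\<dots> \<le> real n / real m" using mpos by (simp add: frac_le)
    finally have "(1 - r) * (w * S) \<le> K" using nm by linarith
    moreover have "(1 - r) * (w * S) \<ge> 0" using r1 w S0 by simp
    ultimately have 3: "\<bar>g * (real m * S) / x - w * S\<bar> \<le> K"
      unfolding mg by (simp add: left_diff_distrib)
    have "\<bar>p - v\<bar> \<le> \<alpha> + \<beta> + \<gamma>"
      if "\<bar>p - q\<bar> \<le> \<alpha>" "\<bar>q - u\<bar> \<le> \<beta>" "\<bar>u - v\<bar> \<le> \<gamma>" for p q u v \<alpha> \<beta> \<gamma> :: real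
      using that by linarith
    from this[OF 1 2 3] show ?thesis .
  qed
  have "\<bar>S + real m * H - L\<bar> \<le> 2 * real n / real m + 1"
    using weight_norm_approx[of m "a - 1" n] a m unfolding S_def H_def L_def by simp
  also have "\<dots> \<le> 2 * K + 1" using nm by simp
  finally have "\<bar>S + real m * H - L\<bar> * w \<le> (2 * K + 1) * 1"
    using w by (intro mult_mono) auto
  moreover have "\<bar>S + real m * H - L\<bar> * w = \<bar>w * S + real m * w * H - L * w\<bar>"
  proof -
    have "\<bar>S + real m * H - L\<bar> * w = \<bar>(S + real m * H - L) * w\<bar>" using w by (simp add: abs_mult)
    also have "(S + real m * H - L) * w = w * S + real m * w * H - L * w" by (simp add: algebra_simps)
    finally show ?thesis .
  qed
  ultimately have L: "\<bar>w * S + real m * w * H - L * w\<bar> \<le> 2 * K + 1" by simp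
  have "1 * e \<le> K\<^sup>2 * e" "K * e \<le> K\<^sup>2 * e"
    using e K K2 by (intro mult_right_mono; linarith)+
  then show ?thesis
    using B F L K unfolding split L_def[symmetric] w_def[symmetric] e_def[symmetric] by linarith
qed

section \<open>The largest eigenvalue\<close>

text \<open>
  The vector \<open>weight m\<close> is fed into the Collatz--Wielandt bound.  The absolute row error of
  \<open>row_sum_approx\<close> becomes a relative one because the weights are at least \<open>c / 2\<close>.
\<close>
lemma lambda_max_typical:
  fixes c \<delta> :: real
  assumes c: "0 < c" "c < 1 / 2" and m: "real m = c * real n" "m \<ge> 1"
    and G: "G \<in> set_pmf (dense_BA n m)" "G \<in> typical_graphs n m (\<delta> * real n)" and \<delta>: "\<delta> \<ge> 0"
  shows "\<bar>(lambda_max ((1 / sqrt (real m)) \<cdot>\<^sub>m adjacency_mat n G) - alpha c / sqrt c * sqrt (real n)) / sqrt (real n)\<bar>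
           \<le> 12 / c ^ 4 * \<delta> + 8 / c ^ 3 / real n"
proof -
  define K where "K = 1 / c"
  have K: "K \<ge> 1" "real n = K * real m" using c m by (auto simp: K_def field_simps)
  have mpos: "real m \<ge> 1" using m by simp
  have npos: "real n > 0" using K mpos by simp
  have "real m < real n" using c m npos by simp
  then have n: "m + 1 \<le> n" by simp
  have GB: "G \<in> set_pmf (BA_at m (n - (m + 1)))" using G(1) by (simp add: dense_BA_def)
  define L where "L = real m + real m / 2 * ln ((2 * real n - real m) / real m)"
  define E where "E = 6 * K\<^sup>2 * (\<delta> * real n) + 4 * K"
  have E: "E \<ge> 0" using K \<delta> by (simp add: E_def)
  have L: "L = alpha c * real n"
  proof -
    have "(2 * real n - real m) / real m = (2 - c) / c"
      using npos c by (simp add: m field_simps)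
    then show ?thesis by (simp add: L_def alpha_def m algebra_simps)
  qed
  have w: "weight m i \<ge> 1 / (2 * K)" if "i \<le> n" for i
  proof -
    have "growth m i \<le> 2 * K"
    proof (cases "m + 1 \<le> i")
      case True
      have "(growth m i)\<^sup>2 \<le> (norm_total_deg m i - 1) / real m" by (rule growth_squared_upper[OF True m(2)])
      also have "\<dots> \<le> 2 * real n / real m"
        using that by (intro divide_right_mono) (auto simp: norm_total_deg_def)
      also have "\<dots> = 2 * K" using K mpos by simp
      also have "\<dots> \<le> (2 * K)\<^sup>2" using K by (simp add: power2_eq_square)
      finally show ?thesis by (rule power2_le_imp_le) (use K in simp)
    qed (use K in \<open>simp add: growth_initial\<close>)
    then show ?thesis unfolding weight_def using growth_pos[of m i] by (intro divide_left_mono) auto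
  qed
  define A where "A = (1 / sqrt (real m)) \<cdot>\<^sub>m adjacency_mat n G"
  define b where "b = 2 * K * E / sqrt (real m)"
  have A: "A \<in> carrier_mat n n" by (simp add: A_def adjacency_mat_def)
  have A_entry: "A $$ (i, j) = real (G (Suc i) (Suc j)) / sqrt (real m)" if "i < n" "j < n" for i j
    using that by (simp add: A_def adjacency_mat_def)
  have row: "\<bar>(\<Sum>j<n. A $$ (i, j) * weight m (Suc j)) - L / sqrt (real m) * weight m (Suc i)\<bar>
               \<le> b * weight m (Suc i)" if i: "i < n" for i
  proof -
    have "(\<Sum>j<n. A $$ (i, j) * weight m (Suc j))
        = (\<Sum>j<n. real (G (Suc i) (Suc j)) * weight m (Suc j)) / sqrt (real m)"
      unfolding sum_divide_distrib using i by (intro sum.cong) (auto simp: A_entry)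
    also have "(\<Sum>j<n. real (G (Suc i) (Suc j)) * weight m (Suc j)) = (\<Sum>j\<in>{1..n}. real (G (Suc i) j) * weight m j)"
      by (rule sum.reindex_bij_witness[of _ "\<lambda>j. j - 1" Suc]) auto
    finally have eq: "(\<Sum>j<n. A $$ (i, j) * weight m (Suc j)) - L / sqrt (real m) * weight m (Suc i)
        = ((\<Sum>j\<in>{1..n}. real (G (Suc i) j) * weight m j) - L * weight m (Suc i)) / sqrt (real m)"
      by (simp add: diff_divide_distrib)
    have "\<bar>(\<Sum>j\<in>{1..n}. real (G (Suc i) j) * weight m j) - L * weight m (Suc i)\<bar> \<le> E"
      unfolding L_def E_def
    proof (rule row_sum_approx[OF m(2) n K(1)])
      show "G (Suc i) (Suc i) = 0" by (rule BA_at_symmetric_loopless(2)[OF m(2) GB])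
    qed (use G(2) i K \<delta> in \<open>auto simp: typical_graphs_def degree_deviation_def new_row_deviation_def\<close>)
    also have "E \<le> 2 * K * E * weight m (Suc i)"
    proof -
      have "1 \<le> 2 * K * weight m (Suc i)" using w[of "Suc i"] i K by (simp add: field_simps)
      then have "1 * E \<le> 2 * K * weight m (Suc i) * E" using E by (intro mult_right_mono)
      then show ?thesis by (simp add: mult_ac)
    qed
    finally show ?thesis unfolding eq abs_divide b_def
      by (simp add: divide_right_mono)
  qed
  have "\<bar>lambda_max A - L / sqrt (real m)\<bar> \<le> b"
  proof (rule lambda_max_Collatz_Wielandt[OF A, where v = "\<lambda>i. weight m (Suc i)"])
    show "A $$ (i, j) = A $$ (j, i)" if "i < n" "j < n" for i j
      using that BA_at_symmetric_loopless(1)[OF m(2) GB] by (simp add: A_entry)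
  qed (use row n weight_pos in \<open>auto simp: A_entry\<close>)
  moreover have "L / sqrt (real m) = alpha c / sqrt c * sqrt (real n)"
    using npos c by (simp add: L m real_sqrt_mult field_simps)
  ultimately have "\<bar>(lambda_max A - alpha c / sqrt c * sqrt (real n)) / sqrt (real n)\<bar> \<le> b / sqrt (real n)"
    by (simp add: abs_divide divide_right_mono)
  also have "b / sqrt (real n) = 2 * K * E / (sqrt c * real n)"
    using npos by (simp add: b_def m real_sqrt_mult)
  also have "\<dots> \<le> 2 * K * E / (c * real n)"
  proof -
    have "c \<le> sqrt c" using c by (intro real_le_rsqrt) (simp add: power2_eq_square)
    then show ?thesis using c npos K E by (intro divide_left_mono mult_right_mono) auto
  qed
  also have "\<dots> = 12 / c ^ 4 * \<delta> + 8 / c ^ 3 / real n"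
    using npos c by (simp add: E_def K_def field_simps power2_eq_square power3_eq_cube power4_eq_xxxx)
  finally show ?thesis by (simp add: A_def)
qed

theorem theorem1p2:
  fixes c :: real and m :: "nat \<Rightarrow> nat"
  assumes "c \<in> \<rat>" and "0 < c" and "c < 1 / 2"
    and "\<And>n. c * real n \<in> \<int> \<Longrightarrow> real (m n) = c * real n"
  shows "small_o_prob (integral_multiples c)
           (\<lambda>n. measure_pmf (dense_BA n (m n)))
           (\<lambda>n G. lambda_max ((1 / sqrt (real (m n))) \<cdot>\<^sub>m adjacency_mat n G)
                    - alpha c / sqrt c * sqrt (real n))
           (\<lambda>n. sqrt (real n))"
  unfolding small_o_prob_def
proof (intro allI impI)
  fix \<epsilon> :: real assume \<epsilon>: "\<epsilon> > 0"
  \<comment> \<open>Then the term \<open>12 \<delta> / c\<^sup>4\<close> of \<open>lambda_max_typical\<close> equals \<open>\<epsilon> / 2\<close>.\<close>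
  define \<delta> where "\<delta> = \<epsilon> * c ^ 4 / 24"
  \<comment> \<open>The first bound is the range in which the exponential moments are controlled; the second makes the
    quadratic term \<open>4 \<eta>\<^sup>2 n\<close> at most half of the linear gain \<open>\<eta> \<delta> n\<close>.\<close>
  define \<eta> where "\<eta> = min (c / 4) (\<delta> / 8)"
  define \<kappa> where "\<kappa> = \<eta> * \<delta> / 2"
  have \<delta>: "\<delta> > 0" using \<epsilon> assms(2) by (simp add: \<delta>_def)
  have \<eta>: "0 < \<eta>" "4 * \<eta> \<le> c" "8 * \<eta> \<le> \<delta>" using \<delta> assms(2) by (auto simp: \<eta>_def)
  have \<kappa>: "\<kappa> > 0" using \<delta> \<eta> by (simp add: \<kappa>_def)
  let ?X = "\<lambda>n G. (lambda_max ((1 / sqrt (real (m n))) \<cdot>\<^sub>m adjacency_mat n G)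
                    - alpha c / sqrt c * sqrt (real n)) / sqrt (real n)"
  let ?p = "\<lambda>n. measure (measure_pmf (dense_BA n (m n))) {G \<in> space (measure_pmf (dense_BA n (m n))). \<bar>?X n G\<bar> > \<epsilon>}"
  have bound: "?p n \<le> 4 * (real n)\<^sup>2 * exp (- \<kappa> * real n)"
    if n: "c * real n \<in> \<int>" "real n \<ge> 16 / c ^ 3 / \<epsilon>" "n \<ge> 1" for n
  proof -
    have mn: "real (m n) = c * real n" by (rule assms(4)[OF n(1)])
    then have "real (m n) > 0" using n assms(2) by simp
    then have m1: "m n \<ge> 1" by simp
    have sub: "{G. \<bar>?X n G\<bar> > \<epsilon>} \<inter> set_pmf (dense_BA n (m n)) \<subseteq> - typical_graphs n (m n) (\<delta> * real n)"
    proof (clarify)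
      fix G assume G: "G \<in> set_pmf (dense_BA n (m n))" "G \<in> typical_graphs n (m n) (\<delta> * real n)"
        and big: "\<bar>?X n G\<bar> > \<epsilon>"
      have "\<bar>?X n G\<bar> \<le> 12 / c ^ 4 * \<delta> + 8 / c ^ 3 / real n"
        using lambda_max_typical[OF assms(2,3) mn m1 G] \<delta> by simp
      also have "12 / c ^ 4 * \<delta> = \<epsilon> / 2" using assms(2) by (simp add: \<delta>_def)
      also have "8 / c ^ 3 / real n \<le> \<epsilon> / 2"
        using n \<epsilon> assms(2) by (simp add: field_simps)
      finally show False using big by simp
    qed
    have "?p n = measure (measure_pmf (dense_BA n (m n))) ({G. \<bar>?X n G\<bar> > \<epsilon>} \<inter> set_pmf (dense_BA n (m n)))"
      by (simp add: measure_Int_set_pmf)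
    also have "\<dots> \<le> measure (measure_pmf (dense_BA n (m n))) (- typical_graphs n (m n) (\<delta> * real n))"
      by (rule measure_pmf.finite_measure_mono[OF sub]) simp
    also have "\<dots> \<le> 4 * (real n)\<^sup>2 * exp (4 * \<eta>\<^sup>2 * real n - \<eta> * (\<delta> * real n))"
      using \<eta> by (intro prob_not_typical m1) (auto simp: mn mult_right_mono)
    also have "\<dots> \<le> 4 * (real n)\<^sup>2 * exp (- \<kappa> * real n)"
    proof (intro mult_left_mono iffD2[OF exp_le_cancel_iff])
      have "8 * \<eta> * (\<eta> * real n) \<le> \<delta> * (\<eta> * real n)" using \<eta> by (intro mult_right_mono) auto
      then show "4 * \<eta>\<^sup>2 * real n - \<eta> * (\<delta> * real n) \<le> - \<kappa> * real n"
        by (simp add: \<kappa>_def power2_eq_square algebra_simps)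
    qed simp
    finally show ?thesis .
  qed
  have "(\<lambda>n. 4 * (real n)\<^sup>2 * exp (- \<kappa> * real n)) \<longlonglongrightarrow> 0"
    using \<kappa> by real_asymp
  then have lim: "((\<lambda>n. 4 * (real n)\<^sup>2 * exp (- \<kappa> * real n)) \<longlongrightarrow> 0) (integral_multiples c)"
    unfolding integral_multiples_def by (rule tendsto_mono[OF inf_le1])
  have "eventually (\<lambda>n. real n \<ge> 16 / c ^ 3 / \<epsilon> \<and> n \<ge> 1) sequentially"
    using eventually_ge_at_top[of "nat \<lceil>16 / c ^ 3 / \<epsilon>\<rceil>"] eventually_ge_at_top[of "1::nat"]
    by eventually_elim linarith
  then have "eventually (\<lambda>n. ?p n \<le> 4 * (real n)\<^sup>2 * exp (- \<kappa> * real n)) (integral_multiples c)"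
    unfolding integral_multiples_def eventually_inf_principal
    by (rule eventually_mono) (use bound in auto)
  then show "(?p \<longlongrightarrow> 0) (integral_multiples c)"
    by (intro tendsto_sandwich[OF _ _ tendsto_const lim]) (auto intro: always_eventually)
qed

end
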